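(* Let $W_0=\{W_0(t);t\ge0\}$ be a one-dimensional standard Brownian motion. Then, as $r\to0$, $$W_0^{(r)}:=\Big\{\big(\gamma_1(r)W_0(t/\gamma_1^2(r)),\dots,\gamma_J(r)W_0(t/\gamma_J^2(r))\big);\ t\ge0\Big\}\Longrightarrow W_0^*:=\Big\{\big(W_{0,1}^*(t),\dots,W_{0,J}^*(t)\big);\ t\ge0\Big\},$$ where $W_0^*$ is a $J$-dimensional standard Brownian motion.
   Context: $J\ge1$. The scale functions $\gamma_1,\dots,\gamma_J:(0,1)\to(0,\infty)$ are strictly increasing, $\lim_{r\to0}\gamma_j(r)=0$ for each $j$, $\lim_{r\to0}\gamma_j(r)/\gamma_i(r)=0$ for $1\le i<j\le J$, and, for a fixed $\varepsilon\in(0,1)$, $\lim_{r\to0}\gamma_1(r)^{(2-\varepsilon)/(2+\varepsilon)}\sqrt{\log\log(1/\gamma_1(r))}\,\log\log(1/\gamma_J(r))=0$. $\Longrightarrow$ denotes weak convergence in $C([0,\infty),\mathbb R^J)$ with the topology of uniform convergence on compact time intervals. A $J$-dimensional standard Brownian motion has independent coordinates, each a one-dimensional standard Brownian motion started at $0$. *)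

theory Defs
  imports "HOL-Probability.Probability"
begin

text \<open>The space \<open>C([0,\<infinity>), E)\<close>; the values outside \<open>[0,\<infinity>)\<close> are fixed by extensionality.\<close>

typedef (overloaded) ('a::topological_space) cpath =
  "{w :: real \<Rightarrow> 'a. w \<in> extensional {0..} \<and> continuous_on {0..} w}"
  morphisms cpath_apply Abs_cpath
  by (rule exI [of _ "restrict (\<lambda>_. undefined) {0..}"]) (auto cong: continuous_on_cong)

text \<open>Only meaningful for \<open>w\<close> continuous on \<open>[0,\<infinity>)\<close>.\<close>

definition cpath_of :: "(real \<Rightarrow> 'a::topological_space) \<Rightarrow> 'a cpath" where
  "cpath_of w = Abs_cpath (restrict w {0..})"

lemma cpath_apply_cpath_of:
  assumes "continuous_on {0..} w" "t \<ge> 0"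
  shows "cpath_apply (cpath_of w) t = w t"
proof -
  have "continuous_on {0..} (restrict w {0..})"
    using assms(1) by (rule continuous_on_eq) simp
  then show ?thesis
    using assms(2) by (simp add: cpath_of_def Abs_cpath_inverse)
qed

text \<open>The topology of uniform convergence on compact time intervals, characterised as such by
  the lemma \<open>tendsto_cpath_iff\<close> below.\<close>

instantiation cpath :: (metric_space) topological_space
begin

definition open_cpath :: "'a cpath set \<Rightarrow> bool" where
  "open_cpath U \<longleftrightarrow> (\<forall>w\<in>U. \<exists>T. \<exists>e>0. \<forall>v.
     (\<forall>t\<in>{0..T}. dist (cpath_apply v t) (cpath_apply w t) < e) \<longrightarrow> v \<in> U)"

instance
proof
  show "open (UNIV :: 'a cpath set)"
    by (auto simp: open_cpath_def intro: exI [of _ 1])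
next
  fix S U :: "'a cpath set"
  assume S: "open S" and U: "open U"
  show "open (S \<inter> U)"
    unfolding open_cpath_def
  proof
    fix w assume w: "w \<in> S \<inter> U"
    obtain T1 e1 where 1: "e1 > 0"
      "\<And>v. \<forall>t\<in>{0..T1}. dist (cpath_apply v t) (cpath_apply w t) < e1 \<Longrightarrow> v \<in> S"
      using S w unfolding open_cpath_def by (metis IntD1)
    obtain T2 e2 where 2: "e2 > 0"
      "\<And>v. \<forall>t\<in>{0..T2}. dist (cpath_apply v t) (cpath_apply w t) < e2 \<Longrightarrow> v \<in> U"
      using U w unfolding open_cpath_def by (metis IntD2)
    show "\<exists>T. \<exists>e>0. \<forall>v. (\<forall>t\<in>{0..T}. dist (cpath_apply v t) (cpath_apply w t) < e)
        \<longrightarrow> v \<in> S \<inter> U"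
      by (rule exI [of _ "max T1 T2"], rule exI [of _ "min e1 e2"]) (auto simp: 1(1) 2(1) intro!: 1(2) 2(2))
  qed
next
  fix K :: "'a cpath set set"
  assume "\<forall>S\<in>K. open S"
  then show "open (\<Union>K)"
    unfolding open_cpath_def by (meson Union_iff)
qed

end

lemma tendsto_cpath_iff:
  fixes l :: "'a::metric_space cpath"
  shows "(f \<longlongrightarrow> l) F \<longleftrightarrow> (\<forall>T. uniform_limit {0..T} (\<lambda>i. cpath_apply (f i)) (cpath_apply l) F)"
proof
  assume L: "(f \<longlongrightarrow> l) F"
  show "\<forall>T. uniform_limit {0..T} (\<lambda>i. cpath_apply (f i)) (cpath_apply l) F"
  proof (intro allI uniform_limitI)
    fix T e :: real assume "e > 0"
    define U where "U = {v. \<exists>d<e. \<forall>t\<in>{0..T}. dist (cpath_apply v t) (cpath_apply l t) \<le> d}"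
    have "open U"
      unfolding open_cpath_def
    proof
      fix w assume "w \<in> U"
      then obtain d where d: "d < e" "\<And>t. t \<in> {0..T} \<Longrightarrow> dist (cpath_apply w t) (cpath_apply l t) \<le> d"
        by (auto simp: U_def)
      have "v \<in> U" if v: "\<forall>t\<in>{0..T}. dist (cpath_apply v t) (cpath_apply w t) < (e - d) / 2" for v
      proof -
        have "dist (cpath_apply v t) (cpath_apply l t) \<le> (e + d) / 2" if "t \<in> {0..T}" for t
          using v [rule_format, OF that] d(2) [OF that]
            dist_triangle [of "cpath_apply v t" "cpath_apply l t" "cpath_apply w t"]
          by (simp add: field_simps)
        then show ?thesis
          unfolding U_def using d(1) by (intro CollectI exI [of _ "(e + d) / 2"]) auto
      qed
      then show "\<exists>T. \<exists>e>0. \<forall>v. (\<forall>t\<in>{0..T}. dist (cpath_apply v t) (cpath_apply w t) < e) \<longrightarrow> v \<in> U"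
        using d(1) by (intro exI [of _ T] exI [of _ "(e - d) / 2"]) auto
    qed
    moreover have "l \<in> U"
      using \<open>e > 0\<close> by (auto simp: U_def)
    ultimately have "\<forall>\<^sub>F i in F. f i \<in> U"
      using L by (simp add: tendsto_def)
    then show "\<forall>\<^sub>F i in F. \<forall>t\<in>{0..T}. dist (cpath_apply (f i) t) (cpath_apply l t) < e"
      by eventually_elim (force simp: U_def)
  qed
next
  assume R: "\<forall>T. uniform_limit {0..T} (\<lambda>i. cpath_apply (f i)) (cpath_apply l) F"
  show "(f \<longlongrightarrow> l) F"
  proof (rule topological_tendstoI)
    fix U assume "open U" "l \<in> U"
    then obtain T e where "e > 0"
      and U: "\<And>v. \<forall>t\<in>{0..T}. dist (cpath_apply v t) (cpath_apply l t) < e \<Longrightarrow> v \<in> U"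
      unfolding open_cpath_def by metis
    have "\<forall>\<^sub>F i in F. \<forall>t\<in>{0..T}. dist (cpath_apply (f i) t) (cpath_apply l t) < e"
      using R \<open>e > 0\<close> by (auto dest: uniform_limitD)
    then show "\<forall>\<^sub>F i in F. f i \<in> U"
      by eventually_elim (rule U)
  qed
qed

text \<open>Weak convergence, along the filter \<open>F\<close>, of the random elements \<open>X i\<close> on \<open>M\<close> to the random
  element \<open>Y\<close> on \<open>N\<close>. The measurability requirements exclude junk values of the integrals.\<close>

definition weakly_converges ::
  "'w measure \<Rightarrow> ('i \<Rightarrow> 'w \<Rightarrow> 'a::topological_space) \<Rightarrow> 'v measure \<Rightarrow> ('v \<Rightarrow> 'a) \<Rightarrow> 'i filter \<Rightarrow> bool"
where
  "weakly_converges M X N Y F \<longleftrightarrow>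
     (\<forall>\<^sub>F i in F. X i \<in> measurable M borel) \<and> Y \<in> measurable N borel \<and>
     (\<forall>f :: 'a \<Rightarrow> real. continuous_on UNIV f \<and> bounded (range f) \<longrightarrow>
        ((\<lambda>i. \<integral>\<omega>. f (X i \<omega>) \<partial>M) \<longlongrightarrow> (\<integral>\<omega>. f (Y \<omega>) \<partial>N)) F)"

locale standard_brownian_motion = prob_space M for M :: "'w measure" +
  fixes W :: "real \<Rightarrow> 'w \<Rightarrow> real"
  assumes measurable_at: "\<And>t. 0 \<le> t \<Longrightarrow> random_variable borel (W t)"
    and starts_at_0: "AE \<omega> in M. W 0 \<omega> = 0"
    and independent_increments: "\<And>(n::nat) (t :: nat \<Rightarrow> real).
      0 \<le> t 0 \<Longrightarrow> (\<And>i. i < n \<Longrightarrow> t i < t (Suc i)) \<Longrightarrow>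
      indep_vars (\<lambda>_. borel) (\<lambda>i \<omega>. W (t (Suc i)) \<omega> - W (t i) \<omega>) {..<n}"
    and normal_increments: "\<And>s t. 0 \<le> s \<Longrightarrow> s < t \<Longrightarrow>
      distributed M lborel (\<lambda>\<omega>. W t \<omega> - W s \<omega>) (normal_density 0 (sqrt (t - s)))"
    and continuous_paths: "\<And>\<omega>. \<omega> \<in> space M \<Longrightarrow> continuous_on {0..} (\<lambda>t. W t \<omega>)"

text \<open>The coordinates are independent as processes, i.e. as random elements of the product
  space \<open>\<real>\<^bsup>[0,\<infinity>)\<^esup>\<close>.\<close>

locale standard_brownian_motion_vec = prob_space M for M :: "'w measure" +
  fixes W :: "real \<Rightarrow> 'w \<Rightarrow> real ^ 'j"
  assumes coordinate: "\<And>j. standard_brownian_motion M (\<lambda>t \<omega>. W t \<omega> $ j)"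
    and independent_coordinates:
      "indep_vars (\<lambda>_. PiM {0..} (\<lambda>_. borel)) (\<lambda>j \<omega>. \<lambda>t\<in>{0..}. W t \<omega> $ j) UNIV"

end

theory Submission
  imports Defs
begin

text \<open>The rescaled motions \<open>X j t = \<gamma> j r * W0 (t / (\<gamma> j r)\<^sup>2)\<close> are all driven by the same
  \<open>W0\<close>, but each of them looks at \<open>W0\<close> on its own time scale, and because the ratios of the scale
  functions tend to zero, the window used by coordinate \<open>j\<close> is much longer than the windows used
  by all the previous coordinates together.  Skipping those earlier windows therefore hardly
  changes coordinate \<open>j\<close>, and makes it exactly independent of the others.

  In detail, fix a time horizon \<open>k\<close>, put \<open>K = k + 1\<close>, and let coordinate \<open>j\<close> start reading \<open>W0\<close> only at the
  time \<open>a j = (\<Sum>i<j. K / (\<gamma> i r)\<^sup>2)\<close>, that is, take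
  \<open>V j t = \<gamma> j r * (W0 (a j + t / (\<gamma> j r)\<^sup>2) - W0 (a j))\<close>.  Up to time \<open>K\<close> the processes \<open>V j\<close> use
  increments of \<open>W0\<close> over non-overlapping blocks, so they are independent (\<open>indep_blocks\<close>), and each of
  them is a Brownian motion (\<open>brownian_restart\<close>).  Hence \<open>(V j)\<^sub>j\<close> stopped at \<open>k\<close> has, for every single \<open>r\<close>,
  exactly the law of the limit stopped at \<open>k\<close>.  On the other hand, \<open>V j t = X j (s + t) - X j s\<close> for
  the shift \<open>s = a j * (\<gamma> j r)\<^sup>2 = (\<Sum>i<j. K * (\<gamma> j r / \<gamma> i r)\<^sup>2)\<close>, which tends to \<open>0\<close>.  As \<open>X j\<close> is a
  Brownian motion whose law does not depend on \<open>r\<close>, \<open>X j\<close> and \<open>V j\<close> are uniformly close on \<open>[0,k]\<close>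
  with high probability (\<open>small_shift_oscillation\<close>).

  This coupling replaces tightness and convergence of finite-dimensional distributions.  What
  remains is a soft statement on the path space (\<open>weakly_converges_approx\<close>): if for every \<open>k\<close> the random
  paths can be approximated uniformly on \<open>[0,k]\<close>, in probability, by random paths with the law of the
  limit stopped at \<open>k\<close>, then they converge weakly.  Equality of laws on the path space is reduced
  to equality of laws on the product space \<open>\<real>\<^bsup>[0,\<infinity>)\<^esup>\<close>, because the Borel sets of the path space are
  generated by the evaluations (\<open>borel_cpath_vimage\<close>).\<close>

section \<open>The Borel sets of the path space\<close>

lemma cpath_apply_extensional: "cpath_apply w \<in> extensional {0..}"
  and cpath_apply_continuous: "continuous_on {0..} (cpath_apply w)"
  using cpath_apply[of w] by auto

lemma cpath_apply_eq_restrict: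
  assumes "continuous_on {0..} w"
  shows "cpath_apply (cpath_of w) = (\<lambda>t\<in>{0..}. w t)"
proof
  fix t show "cpath_apply (cpath_of w) t = (\<lambda>t\<in>{0..}. w t) t"
    using cpath_apply_cpath_of[OF assms, of t]
      extensional_arb[OF cpath_apply_extensional[of "cpath_of w"], of t]
    by (cases "t \<ge> 0") auto
qed

lemma cpath_apply_in_PiM: "cpath_apply w \<in> space (PiM {0..} (\<lambda>_. borel))"
  using cpath_apply_extensional[of w] by (simp add: space_PiM PiE_def)

lemma continuous_le_on_Rats:
  fixes f :: "real \<Rightarrow> real"
  assumes "a < b" "continuous_on {a..b} f" "\<And>t. t \<in> \<rat> \<Longrightarrow> a \<le> t \<Longrightarrow> t \<le> b \<Longrightarrow> f t \<le> c"
    and "t \<in> {a..b}"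
  shows "f t \<le> c"
proof -
  have cl: "closure ({a<..<b} \<inter> \<rat>) = {a..b}"
    using closure_open_Int_superset[of "{a<..<b}" \<rat>] assms(1) by (simp add: Rats_closure_real)
  show ?thesis
    by (rule continuous_le_on_closure[of "{a<..<b} \<inter> \<rat>" f t c]) (use assms cl in auto)
qed

text \<open>An open set is a countable union of tubes around step functions: the paths that stay, on each
  of finitely many consecutive intervals of length \<open>1/(n+1)\<close>, within \<open>1/(m+1)\<close> of a point of a countable
  dense set.  By continuity a tube only constrains the values at rational times, so that it is
  measurable for the product sigma-algebra.\<close>

lemma open_cpath_vimage_PiM:
  fixes U :: "'a::{metric_space,second_countable_topology} cpath set"
  assumes "open U"
  obtains A where "A \<in> sets (PiM {0..} (\<lambda>_. borel))" "U = cpath_apply -` A"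
proof -
  obtain D :: "'a set" where D: "countable D" "\<And>X. open X \<Longrightarrow> X \<noteq> {} \<Longrightarrow> \<exists>d\<in>D. d \<in> X"
    using countable_dense_setE by blast
  let ?P = "PiM {0..} (\<lambda>_. borel) :: (real \<Rightarrow> 'a) measure"
  define tube where "tube = (\<lambda>(n::nat, q::'a list, m::nat).
    {x \<in> space ?P. \<forall>t\<in>{0..}\<inter>\<rat>. \<forall>k<length q.
       real k / real (Suc n) \<le> t \<and> t \<le> real (Suc k) / real (Suc n) \<longrightarrow> dist (x t) (q ! k) \<le> 1 / real (Suc m)})"
  define I where "I = {i \<in> UNIV \<times> lists D \<times> UNIV. cpath_apply -` tube i \<subseteq> U}"
  have tube_sets: "tube i \<in> sets ?P" for i
  proof -
    obtain n q m where i: "i = (n, q, m)" by (cases i)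
    have [measurable]: "countable ({0..} \<inter> \<rat> :: real set)"
      using countable_rat by blast
    show ?thesis
      unfolding i tube_def prod.case by measurable
  qed
  have "countable I"
    unfolding I_def by (rule countable_subset[of _ "UNIV \<times> lists D \<times> UNIV"]) (use D in auto)
  then have sets: "(\<Union>i\<in>I. tube i) \<in> sets ?P"
    using tube_sets by auto
  have "w \<in> cpath_apply -` (\<Union>i\<in>I. tube i)" if w: "w \<in> U" for w
  proof -
    obtain T e where "e > 0"
      and U: "\<And>v. \<forall>t\<in>{0..T}. dist (cpath_apply v t) (cpath_apply w t) < e \<Longrightarrow> v \<in> U"
      using assms w unfolding open_cpath_def by metis
    obtain m where m: "2 / real (Suc m) < e"
      using reals_Archimedean[of "e / 2"] \<open>e > 0\<close> by (auto simp: field_simps)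
    define L where "L = nat \<lceil>T\<rceil> + 1"
    have L: "T \<le> real L" unfolding L_def by linarith
    have "uniformly_continuous_on {0..real L} (cpath_apply w)"
      by (intro compact_uniformly_continuous continuous_on_subset[OF cpath_apply_continuous]) auto
    then obtain d where d: "d > 0" "\<And>s t. s \<in> {0..real L} \<Longrightarrow> t \<in> {0..real L} \<Longrightarrow> dist t s < d \<Longrightarrow>
        dist (cpath_apply w t) (cpath_apply w s) < 1 / (2 * real (Suc m))"
      unfolding uniformly_continuous_on_def by (metis divide_pos_pos mult_pos_pos of_nat_0_less_iff zero_less_Suc zero_less_numeral zero_less_one)
    obtain n where n: "1 / real (Suc n) < d"
      using reals_Archimedean[OF d(1)] by (auto simp: field_simps)
    define N where "N = L * Suc n"
    have "\<exists>p\<in>D. dist (cpath_apply w (real k / real (Suc n))) p < 1 / (2 * real (Suc m))" for k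
      using D(2)[of "ball (cpath_apply w (real k / real (Suc n))) (1 / (2 * real (Suc m)))"] by auto
    then obtain p where p: "\<And>k. p k \<in> D"
        "\<And>k. dist (cpath_apply w (real k / real (Suc n))) (p k) < 1 / (2 * real (Suc m))"
      by metis
    \<comment> \<open>the step function that samples \<open>w\<close>, up to rounding into \<open>D\<close>, at the grid points in \<open>[0,L]\<close>\<close>
    define q where "q = map p [0..<N]"
    have q: "length q = N" "\<And>k. k < N \<Longrightarrow> q ! k = p k" "q \<in> lists D"
      using p by (auto simp: q_def)
    have piece: "t \<in> {0..real L}" "real k / real (Suc n) \<in> {0..real L}" "dist t (real k / real (Suc n)) < d"
      if "k < N" "real k / real (Suc n) \<le> t" "t \<le> real (Suc k) / real (Suc n)" for t k
    proof -
      have "real (Suc k) \<le> real L * real (Suc n)"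
        using that(1) unfolding N_def by (metis Suc_leI of_nat_le_iff of_nat_mult)
      then have "real (Suc k) / real (Suc n) \<le> real L"
        by (simp add: field_simps)
      moreover have "real (Suc k) / real (Suc n) = real k / real (Suc n) + 1 / real (Suc n)"
        by (simp add: field_simps)
      moreover have "0 \<le> real k / real (Suc n)" "0 \<le> 1 / real (Suc n)" by auto
      ultimately show "t \<in> {0..real L}" "real k / real (Suc n) \<in> {0..real L}" "dist t (real k / real (Suc n)) < d"
        using that n unfolding dist_real_def atLeastAtMost_iff by linarith+
    qed
    have near: "dist (cpath_apply w t) (p k) \<le> 1 / real (Suc m)"
      if "k < N" "real k / real (Suc n) \<le> t" "t \<le> real (Suc k) / real (Suc n)" for t k
    proof -
      have "dist (cpath_apply w t) (cpath_apply w (real k / real (Suc n))) < 1 / (2 * real (Suc m))"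
        using d(2) piece[OF that] by blast
      then have "dist (cpath_apply w t) (p k) < 1 / (2 * real (Suc m)) + 1 / (2 * real (Suc m))"
        using p(2)[of k] dist_triangle[of "cpath_apply w t" "p k" "cpath_apply w (real k / real (Suc n))"] by linarith
      also have "\<dots> = 1 / real (Suc m)" by (simp add: field_simps)
      finally show ?thesis by simp
    qed
    have "cpath_apply w \<in> tube (n, q, m)"
      unfolding tube_def prod.case using cpath_apply_in_PiM[of w] near by (auto simp: q)
    moreover have "v \<in> U" if v: "cpath_apply v \<in> tube (n, q, m)" for v
    proof (rule U, rule)
      fix t assume t: "t \<in> {0..T}"
      have "dist (cpath_apply v s) (cpath_apply w s) \<le> 2 / real (Suc m)"
        if s: "s \<in> \<rat>" "0 \<le> s" "s \<le> real L" for s :: real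
      proof -
        \<comment> \<open>The right end point \<open>L\<close> belongs to the last interval, not to a new one.\<close>
        obtain k where k: "k < N" "real k / real (Suc n) \<le> s" "s \<le> real (Suc k) / real (Suc n)"
        proof (cases "s = real L")
          case True
          have N: "N > 0" unfolding N_def L_def by simp
          have "real N / real (Suc n) = s" unfolding N_def True by (simp add: field_simps)
          moreover have "real (N - 1) / real (Suc n) \<le> real N / real (Suc n)"
            by (intro divide_right_mono) auto
          ultimately show ?thesis using N by (intro that[of "N - 1"]) auto
        next
          case False
          define k where "k = nat \<lfloor>s * real (Suc n)\<rfloor>"
          have k: "real k \<le> s * real (Suc n)" "s * real (Suc n) < real k + 1"
            unfolding k_def using s(2) by auto
          have Ln: "s * real (Suc n) < real L * real (Suc n)"
            using s(3) False by (intro mult_strict_right_mono) auto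
          have "real k < real N" unfolding N_def of_nat_mult by (rule le_less_trans[OF k(1) Ln])
          then have "k < N" by simp
          moreover have "real k / real (Suc n) \<le> s" "s \<le> real (Suc k) / real (Suc n)"
            using k by (simp_all add: pos_divide_le_eq pos_le_divide_eq del: of_nat_Suc)
          ultimately show ?thesis by (rule that)
        qed
        have tube_v: "\<And>t k. t \<in> {0..}\<inter>\<rat> \<Longrightarrow> k < length q \<Longrightarrow>
            real k / real (Suc n) \<le> t \<and> t \<le> real (Suc k) / real (Suc n) \<Longrightarrow>
            dist (cpath_apply v t) (q ! k) \<le> 1 / real (Suc m)"
          using v unfolding tube_def prod.case by blast
        have "dist (cpath_apply v s) (q ! k) \<le> 1 / real (Suc m)"
          using s k q(1) by (intro tube_v conjI) auto
        then have "dist (cpath_apply v s) (p k) \<le> 1 / real (Suc m)"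
          unfolding q(2)[OF k(1)] .
        with near[OF k] show ?thesis
          using dist_triangle2[of "cpath_apply v s" "cpath_apply w s" "p k"]
          by linarith
      qed
      moreover have "continuous_on {0..real L} (\<lambda>s. dist (cpath_apply v s) (cpath_apply w s))"
        by (intro continuous_intros continuous_on_subset[OF cpath_apply_continuous]) auto
      moreover have "L > 0" by (simp add: L_def)
      then have "0 < real L" "t \<in> {0..real L}" using t L by auto
      ultimately have "dist (cpath_apply v t) (cpath_apply w t) \<le> 2 / real (Suc m)"
        using continuous_le_on_Rats[of 0 "real L" "\<lambda>s. dist (cpath_apply v s) (cpath_apply w s)"
              "2 / real (Suc m)" t] by blast
      then show "dist (cpath_apply v t) (cpath_apply w t) < e" using m by simp
    qed
    ultimately have "(n, q, m) \<in> I" unfolding I_def using q by auto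
    with \<open>cpath_apply w \<in> tube (n, q, m)\<close> show ?thesis by blast
  qed
  then have "U = cpath_apply -` (\<Union>i\<in>I. tube i)"
    unfolding I_def by blast
  with sets show ?thesis using that by blast
qed

lemma borel_cpath_vimage:
  "sets (borel :: 'a::{metric_space,second_countable_topology} cpath measure) \<subseteq>
   {cpath_apply -` A | A. A \<in> sets (PiM {0..} (\<lambda>_. borel))}"
proof -
  let ?P = "PiM {0..} (\<lambda>_. borel) :: (real \<Rightarrow> 'a) measure"
  let ?V = "vimage_algebra UNIV cpath_apply ?P"
  have V: "sets ?V = {cpath_apply -` A | A. A \<in> sets ?P}"
    using cpath_apply_in_PiM by (subst sets_vimage_algebra2) auto
  have "{S :: 'a cpath set. open S} \<subseteq> sets ?V"
    unfolding V by (auto elim: open_cpath_vimage_PiM)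
  then have "sigma_sets UNIV {S :: 'a cpath set. open S} \<subseteq> sets ?V"
    using sets.sigma_sets_subset[of _ ?V] by simp
  then show ?thesis unfolding V[symmetric] by (simp add: borel_def)
qed

lemma measurable_cpath_of:
  fixes X :: "real \<Rightarrow> 'w \<Rightarrow> 'a::{metric_space,second_countable_topology}"
  assumes "\<And>t. 0 \<le> t \<Longrightarrow> X t \<in> borel_measurable M"
    and "\<And>\<omega>. \<omega> \<in> space M \<Longrightarrow> continuous_on {0..} (\<lambda>t. X t \<omega>)"
  shows "(\<lambda>\<omega>. cpath_of (\<lambda>t. X t \<omega>)) \<in> borel_measurable M"
proof (rule measurableI)
  fix B :: "'a cpath set" assume "B \<in> sets borel"
  then obtain A where A: "A \<in> sets (PiM {0..} (\<lambda>_. borel))" "B = cpath_apply -` A"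
    using borel_cpath_vimage by blast
  have "(\<lambda>\<omega>. \<lambda>t\<in>{0..}. X t \<omega>) \<in> measurable M (PiM {0..} (\<lambda>_. borel))"
    using assms(1) by (intro measurable_restrict) auto
  then have "(\<lambda>\<omega>. \<lambda>t\<in>{0..}. X t \<omega>) -` A \<inter> space M \<in> sets M"
    using A(1) by (rule measurable_sets)
  moreover have "(\<lambda>\<omega>. cpath_of (\<lambda>t. X t \<omega>)) -` B \<inter> space M = (\<lambda>\<omega>. \<lambda>t\<in>{0..}. X t \<omega>) -` A \<inter> space M"
    unfolding A(2) using cpath_apply_eq_restrict[OF assms(2)] by auto
  ultimately show "(\<lambda>\<omega>. cpath_of (\<lambda>t. X t \<omega>)) -` B \<inter> space M \<in> sets M" by simp
qed simp

lemma distr_cpath_of_eqI: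
  fixes X :: "real \<Rightarrow> 'w \<Rightarrow> 'a::{metric_space,second_countable_topology}"
    and Y :: "real \<Rightarrow> 'v \<Rightarrow> 'a"
  assumes X: "\<And>t. 0 \<le> t \<Longrightarrow> X t \<in> borel_measurable M"
    "\<And>\<omega>. \<omega> \<in> space M \<Longrightarrow> continuous_on {0..} (\<lambda>t. X t \<omega>)"
    and Y: "\<And>t. 0 \<le> t \<Longrightarrow> Y t \<in> borel_measurable N"
    "\<And>\<omega>. \<omega> \<in> space N \<Longrightarrow> continuous_on {0..} (\<lambda>t. Y t \<omega>)"
    and eq: "distr M (PiM {0..} (\<lambda>_. borel)) (\<lambda>\<omega>. \<lambda>t\<in>{0..}. X t \<omega>) =
      distr N (PiM {0..} (\<lambda>_. borel)) (\<lambda>\<omega>. \<lambda>t\<in>{0..}. Y t \<omega>)"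
  shows "distr M borel (\<lambda>\<omega>. cpath_of (\<lambda>t. X t \<omega>)) = distr N borel (\<lambda>\<omega>. cpath_of (\<lambda>t. Y t \<omega>))"
proof (rule measure_eqI)
  fix B assume "B \<in> sets (distr M borel (\<lambda>\<omega>. cpath_of (\<lambda>t. X t \<omega>)))"
  then have B: "B \<in> sets borel" by simp
  then obtain A where A: "A \<in> sets (PiM {0..} (\<lambda>_. borel))" "B = cpath_apply -` A"
    using borel_cpath_vimage by blast
  have m: "(\<lambda>\<omega>. \<lambda>t\<in>{0..}. X t \<omega>) \<in> measurable M (PiM {0..} (\<lambda>_. borel))"
    "(\<lambda>\<omega>. \<lambda>t\<in>{0..}. Y t \<omega>) \<in> measurable N (PiM {0..} (\<lambda>_. borel))"
    using X(1) Y(1) by (intro measurable_restrict; auto)+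
  have "emeasure (distr M borel (\<lambda>\<omega>. cpath_of (\<lambda>t. X t \<omega>))) B =
      emeasure M ((\<lambda>\<omega>. \<lambda>t\<in>{0..}. X t \<omega>) -` A \<inter> space M)"
    using B cpath_apply_eq_restrict[OF X(2)]
    by (subst emeasure_distr[OF measurable_cpath_of[OF X]]) (auto simp: A(2) intro!: arg_cong[of _ _ "emeasure M"])
  also have "\<dots> = emeasure N ((\<lambda>\<omega>. \<lambda>t\<in>{0..}. Y t \<omega>) -` A \<inter> space N)"
    using eq emeasure_distr[OF m(1) A(1)] emeasure_distr[OF m(2) A(1)] by simp
  also have "\<dots> = emeasure (distr N borel (\<lambda>\<omega>. cpath_of (\<lambda>t. Y t \<omega>))) B"
    using B cpath_apply_eq_restrict[OF Y(2)]
    by (subst emeasure_distr[OF measurable_cpath_of[OF Y]]) (auto simp: A(2) intro!: arg_cong[of _ _ "emeasure N"])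
  finally show "emeasure (distr M borel (\<lambda>\<omega>. cpath_of (\<lambda>t. X t \<omega>))) B =
    emeasure (distr N borel (\<lambda>\<omega>. cpath_of (\<lambda>t. Y t \<omega>))) B" .
qed simp

section \<open>Weak convergence by approximation on a compact interval\<close>

lemma (in prob_space) integral_diff_le_off_small:
  fixes g h :: "'a \<Rightarrow> real"
  assumes "g \<in> borel_measurable M" "h \<in> borel_measurable M"
    and "\<And>\<omega>. \<bar>g \<omega>\<bar> \<le> C" "\<And>\<omega>. \<bar>h \<omega>\<bar> \<le> C" "A \<in> events" "0 \<le> e"
    and off: "\<And>\<omega>. \<omega> \<in> space M \<Longrightarrow> \<omega> \<notin> A \<Longrightarrow> \<bar>g \<omega> - h \<omega>\<bar> \<le> e"
  shows "\<bar>(\<integral>\<omega>. g \<omega> \<partial>M) - (\<integral>\<omega>. h \<omega> \<partial>M)\<bar> \<le> e + 2 * C * prob A"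
proof -
  have int: "integrable M g" "integrable M h"
    using assms by (auto intro!: integrable_const_bound[where B = C])
  have ind: "integrable M (indicator A :: 'a \<Rightarrow> real)"
    using assms(5) by (intro integrable_real_indicator) (simp_all add: emeasure_eq_measure)
  have "\<bar>(\<integral>\<omega>. g \<omega> \<partial>M) - (\<integral>\<omega>. h \<omega> \<partial>M)\<bar> = \<bar>\<integral>\<omega>. g \<omega> - h \<omega> \<partial>M\<bar>"
    using int by simp
  also have "\<dots> \<le> (\<integral>\<omega>. \<bar>g \<omega> - h \<omega>\<bar> \<partial>M)" by (rule integral_abs_bound)
  also have "\<dots> \<le> (\<integral>\<omega>. e + 2 * C * indicator A \<omega> \<partial>M)"
  proof (rule integral_mono)
    fix \<omega> assume "\<omega> \<in> space M"
    then show "\<bar>g \<omega> - h \<omega>\<bar> \<le> e + 2 * C * indicator A \<omega>"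
      using off[of \<omega>] assms(3,4)[of \<omega>] assms(6) by (auto simp: indicator_def)
  qed (use int ind in auto)
  also have "\<dots> = e + 2 * C * prob A"
    using assms(5) ind by (simp add: prob_space)
  finally show ?thesis .
qed

definition stop :: "real \<Rightarrow> 'a cpath \<Rightarrow> 'a::topological_space cpath" where
  "stop T w = cpath_of (\<lambda>t. cpath_apply w (min t T))"

lemma continuous_on_min_time:
  assumes "continuous_on {0..} w" "0 \<le> T"
  shows "continuous_on {0..} (\<lambda>t::real. w (min t T))"
  using assms(2) by (intro continuous_on_compose2[OF assms(1)] continuous_intros) auto

lemma cpath_apply_stop:
  "0 \<le> T \<Longrightarrow> 0 \<le> t \<Longrightarrow> cpath_apply (stop T w) t = cpath_apply w (min t T)"
  unfolding stop_def
  by (intro cpath_apply_cpath_of continuous_on_min_time cpath_apply_continuous) auto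

lemma stop_cpath_of:
  assumes "continuous_on {0..} w" "0 \<le> T"
  shows "stop T (cpath_of w) = cpath_of (\<lambda>t. w (min t T))"
  unfolding stop_def using assms
  by (auto simp: cpath_of_def[of "\<lambda>t. cpath_apply (cpath_of w) (min t T)"]
      cpath_of_def[of "\<lambda>t. w (min t T)"] cpath_apply_cpath_of intro!: arg_cong[of _ _ Abs_cpath])

text \<open>The paths at which \<open>f\<close> oscillates by more than \<open>e\<close> on the tube of radius \<open>1/(k+1)\<close> over
  \<open>[0,k]\<close>.  The radius \<open>d\<close> is taken strictly smaller so that the set is open.\<close>

definition rough :: "('a::metric_space cpath \<Rightarrow> real) \<Rightarrow> nat \<Rightarrow> real \<Rightarrow> 'a cpath set" where
  "rough f k e = {w. \<exists>v. \<exists>d < 1 / real (Suc k).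
     (\<forall>t\<in>{0..real k}. dist (cpath_apply v t) (cpath_apply w t) \<le> d) \<and> e < \<bar>f v - f w\<bar>}"

lemma roughI:
  assumes "d < 1 / real (Suc k)" "e < \<bar>f v - f w\<bar>"
    and "\<And>t. t \<in> {0..real k} \<Longrightarrow> dist (cpath_apply v t) (cpath_apply w t) \<le> d"
  shows "w \<in> rough f k e"
  using assms unfolding rough_def by blast

lemma roughE:
  assumes "w \<in> rough f k e"
  obtains v d where "d < 1 / real (Suc k)" "e < \<bar>f v - f w\<bar>"
    "\<And>t. t \<in> {0..real k} \<Longrightarrow> dist (cpath_apply v t) (cpath_apply w t) \<le> d"
  using assms unfolding rough_def by blast

lemma open_rough:
  assumes f: "continuous_on UNIV f"
  shows "open (rough f k e)"
  unfolding open_cpath_def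
proof
  fix w assume "w \<in> rough f k e"
  then obtain v d where d: "d < 1 / real (Suc k)" "e < \<bar>f v - f w\<bar>"
    "\<And>t. t \<in> {0..real k} \<Longrightarrow> dist (cpath_apply v t) (cpath_apply w t) \<le> d"
    by (rule roughE) blast
  have "open {u. e < \<bar>f v - f u\<bar>}"
    by (intro open_Collect_less continuous_intros f)
  then obtain T r where r: "r > 0"
    "\<And>u. \<forall>t\<in>{0..T}. dist (cpath_apply u t) (cpath_apply w t) < r \<Longrightarrow> e < \<bar>f v - f u\<bar>"
    using d(2) unfolding open_cpath_def by (metis mem_Collect_eq)
  define s where "s = (1 / real (Suc k) - d) / 2"
  have s: "s > 0" "d + s < 1 / real (Suc k)"
    unfolding s_def using d(1) by (simp_all add: field_simps del: of_nat_Suc)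
  have "u \<in> rough f k e"
    if u: "\<forall>t\<in>{0..max T (real k)}. dist (cpath_apply u t) (cpath_apply w t) < min r s" for u
  proof -
    have "dist (cpath_apply v t) (cpath_apply u t) \<le> d + s" if "t \<in> {0..real k}" for t
      using d(3)[OF that] bspec[OF u, of t] that
        dist_triangle2[of "cpath_apply v t" "cpath_apply u t" "cpath_apply w t"]
      by (simp add: le_max_iff_disj)
    moreover have "e < \<bar>f v - f u\<bar>"
      using u by (intro r(2)) auto
    ultimately show ?thesis using s(2) by (intro roughI[of "d + s"])
  qed
  then show "\<exists>T. \<exists>r>0. \<forall>u. (\<forall>t\<in>{0..T}. dist (cpath_apply u t) (cpath_apply w t) < r) \<longrightarrow> u \<in> rough f k e"
    using r(1) s(1) by (intro exI[of _ "max T (real k)"] exI[of _ "min r s"]) auto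
qed

lemma decseq_rough: "decseq (\<lambda>k. rough f k e)"
proof (rule decseq_SucI, rule)
  fix k w assume "w \<in> rough f (Suc k) e"
  then obtain v d where d: "d < 1 / real (Suc (Suc k))" "e < \<bar>f v - f w\<bar>"
    "\<And>t. t \<in> {0..real (Suc k)} \<Longrightarrow> dist (cpath_apply v t) (cpath_apply w t) \<le> d"
    by (rule roughE) blast
  have "1 / real (Suc (Suc k)) \<le> 1 / real (Suc k)" by (simp add: field_simps)
  with d show "w \<in> rough f k e" by (intro roughI[of d]) auto
qed

text \<open>A fixed path is eventually not rough, by continuity of \<open>f\<close> there.  Since the rough sets decrease,
  any random path is rough with small probability for large \<open>k\<close>; this is how the argument avoids compact
  sets of paths.\<close>

lemma INT_rough_eq_empty:
  assumes f: "continuous_on UNIV f" and "0 < e"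
  shows "(\<Inter>k. rough f k e) = {}"
proof -
  have "\<exists>k. w \<notin> rough f k e" for w
  proof -
    have "open {u. \<bar>f u - f w\<bar> < e}"
      by (intro open_Collect_less continuous_intros f)
    moreover have "w \<in> {u. \<bar>f u - f w\<bar> < e}" using assms by simp
    ultimately obtain T r where r: "r > 0"
      "\<And>u. \<forall>t\<in>{0..T}. dist (cpath_apply u t) (cpath_apply w t) < r \<Longrightarrow> \<bar>f u - f w\<bar> < e"
      unfolding open_cpath_def by (metis mem_Collect_eq)
    obtain m where m: "1 / real (Suc m) < r"
      using reals_Archimedean[OF r(1)] by (auto simp: field_simps)
    define k where "k = max m (nat \<lceil>T\<rceil>)"
    have "1 / real (Suc k) \<le> 1 / real (Suc m)" "T \<le> real k"
      unfolding k_def by (auto simp: field_simps, linarith)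
    note k = this
    have "w \<notin> rough f k e"
    proof
      assume "w \<in> rough f k e"
      then obtain v d where d: "d < 1 / real (Suc k)" "e < \<bar>f v - f w\<bar>"
        "\<And>t. t \<in> {0..real k} \<Longrightarrow> dist (cpath_apply v t) (cpath_apply w t) \<le> d"
        by (rule roughE) blast
      have "dist (cpath_apply v t) (cpath_apply w t) < r" if "t \<in> {0..T}" for t
        using d(1) d(3)[of t] k m that by simp
      with r(2)[of v] d(2) show False by auto
    qed
    then show ?thesis ..
  qed
  then show ?thesis by auto
qed

lemma stop_oscillation_le:
  assumes "w \<notin> rough f k e"
  shows "\<bar>f (stop (real k) w) - f w\<bar> \<le> e"
proof (rule ccontr)
  assume "\<not> \<bar>f (stop (real k) w) - f w\<bar> \<le> e"
  then have "w \<in> rough f k e"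
    by (intro roughI[of 0 _ _ _ "stop (real k) w"]) (auto simp: cpath_apply_stop min_def)
  with assms show False ..
qed

text \<open>A path and its stopped version define the same tube over \<open>[0,k]\<close>.  So if \<open>f\<close> varies by \<open>2 * e\<close>
  between the stopped path and a point of that tube, it varies by \<open>e\<close> between the path and one of those two.\<close>

lemma stop_rough_imp_rough:
  assumes "stop (real k) w \<in> rough f k (2 * e)"
  shows "w \<in> rough f k e"
proof (rule ccontr)
  assume w: "w \<notin> rough f k e"
  obtain v d where d: "d < 1 / real (Suc k)" "2 * e < \<bar>f v - f (stop (real k) w)\<bar>"
    "\<And>t. t \<in> {0..real k} \<Longrightarrow> dist (cpath_apply v t) (cpath_apply (stop (real k) w) t) \<le> d"
    using assms by (rule roughE) blast
  have "dist (cpath_apply v t) (cpath_apply w t) \<le> d" if "t \<in> {0..real k}" for t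
    using d(3)[OF that] that by (simp add: cpath_apply_stop min_absorb1)
  with w d(1) have "\<not> e < \<bar>f v - f w\<bar>" using roughI by blast
  with d(2) stop_oscillation_le[OF w] show False by linarith
qed

text \<open>For a bounded continuous \<open>f\<close> the expectations are compared along
  \<open>X i\<close>, \<open>Y k i\<close>, \<open>stop k Z\<close>, \<open>Z\<close>.  The first two are close because \<open>Y k i\<close> is unlikely to be rough:
  it has the law of \<open>stop k Z\<close>, which can be rough only if \<open>Z\<close> is.  The middle two have the same law.
  The last two are close because \<open>Z\<close> is unlikely to be rough.  The integer \<open>k\<close> is chosen from the law
  of \<open>Z\<close> alone, before \<open>i\<close>.\<close>

lemma weakly_converges_approx:
  fixes X :: "'i \<Rightarrow> 'w \<Rightarrow> 'a::{metric_space,second_countable_topology} cpath"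
    and Z :: "'v \<Rightarrow> 'a cpath" and Y :: "nat \<Rightarrow> 'i \<Rightarrow> 'w \<Rightarrow> 'a cpath"
  assumes M: "prob_space M" and N: "prob_space N"
    and X: "\<forall>\<^sub>F i in F. X i \<in> borel_measurable M" and Z: "Z \<in> borel_measurable N"
    and Zs: "\<And>k. (\<lambda>\<omega>. stop (real k) (Z \<omega>)) \<in> borel_measurable N"
    and Y: "\<And>k. \<forall>\<^sub>F i in F. Y k i \<in> borel_measurable M \<and>
      distr M borel (Y k i) = distr N borel (\<lambda>\<omega>. stop (real k) (Z \<omega>))"
    and close: "\<And>k d e. 0 < d \<Longrightarrow> 0 < e \<Longrightarrow> \<forall>\<^sub>F i in F. \<exists>A\<in>sets M. measure M A < e \<and>
      (\<forall>\<omega>\<in>space M - A. \<forall>t\<in>{0..real k}. dist (cpath_apply (X i \<omega>) t) (cpath_apply (Y k i \<omega>) t) \<le> d)"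
  shows "weakly_converges M X N Z F"
  unfolding weakly_converges_def
proof (intro conjI X Z allI impI)
  interpret M: prob_space M by fact
  interpret N: prob_space N by fact
  fix f :: "'a cpath \<Rightarrow> real" assume "continuous_on UNIV f \<and> bounded (range f)"
  then have f: "continuous_on UNIV f" and "bounded (range f)" by auto
  then obtain C where C: "C > 0" "\<And>w. \<bar>f w\<bar> \<le> C"
    unfolding bounded_pos by auto
  have [measurable]: "f \<in> borel_measurable borel"
    using f by (rule borel_measurable_continuous_onI)
  have [measurable]: "rough f k e \<in> sets borel" for k e
    using open_rough[OF f] by (rule borel_open)
  show "((\<lambda>i. \<integral>\<omega>. f (X i \<omega>) \<partial>M) \<longlongrightarrow> (\<integral>\<omega>. f (Z \<omega>) \<partial>N)) F"
  proof (rule tendstoI)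
    fix e :: real assume "e > 0"
    \<comment> \<open>The three comparisons cost at most \<open>3 * a + 6 * C * p\<close>.\<close>
    define a where "a = e / 8"
    define p where "p = e / (16 * C)"
    have ap: "a > 0" "p > 0" "3 * a + 6 * C * p < e"
      unfolding a_def p_def using \<open>e > 0\<close> C(1) by (auto simp: field_simps)
    have "(\<lambda>k. N.prob (Z -` rough f k a \<inter> space N)) \<longlonglongrightarrow> N.prob (\<Inter>k. Z -` rough f k a \<inter> space N)"
      using Z decseq_rough[of f a]
      by (intro N.finite_Lim_measure_decseq) (auto simp: decseq_def)
    moreover have "(\<Inter>k. Z -` rough f k a \<inter> space N) = {}"
      using INT_rough_eq_empty[OF f ap(1)] by auto
    ultimately have "\<forall>\<^sub>F k in sequentially. N.prob (Z -` rough f k a \<inter> space N) < p"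
      using ap(2) by (simp add: order_tendstoD(2))
    then obtain k where k: "N.prob (Z -` rough f k a \<inter> space N) < p"
      using eventually_happens by fastforce
    let ?S = "\<lambda>\<omega>. stop (real k) (Z \<omega>)"
    note [measurable] = Z Zs[of k]
    have 1: "\<bar>(\<integral>\<omega>. f (?S \<omega>) \<partial>N) - (\<integral>\<omega>. f (Z \<omega>) \<partial>N)\<bar> \<le> a + 2 * C * N.prob (Z -` rough f k a \<inter> space N)"
      using stop_oscillation_le C(2) ap(1)
      by (intro N.integral_diff_le_off_small) auto
    have "\<forall>\<^sub>F i in F. \<exists>A\<in>sets M. measure M A < p \<and> (\<forall>\<omega>\<in>space M - A. \<forall>t\<in>{0..real k}.
        dist (cpath_apply (X i \<omega>) t) (cpath_apply (Y k i \<omega>) t) \<le> 1 / real (Suc (Suc k)))"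
      using ap(2) by (intro close) auto
    then show "\<forall>\<^sub>F i in F. dist (\<integral>\<omega>. f (X i \<omega>) \<partial>M) (\<integral>\<omega>. f (Z \<omega>) \<partial>N) < e"
      using X Y[of k]
    proof eventually_elim
      case (elim i)
      then obtain A where A [measurable]: "A \<in> sets M" and pA: "measure M A < p"
        and cl: "\<And>\<omega> t. \<omega> \<in> space M \<Longrightarrow> \<omega> \<notin> A \<Longrightarrow> t \<in> {0..real k} \<Longrightarrow>
          dist (cpath_apply (X i \<omega>) t) (cpath_apply (Y k i \<omega>) t) \<le> 1 / real (Suc (Suc k))"
        by auto
      note [measurable] = elim(2) conjunct1[OF elim(3)]
      let ?R = "Y k i -` rough f k (2 * a) \<inter> space M"
      have "M.prob ?R = measure (distr M borel (Y k i)) (rough f k (2 * a))"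
        by (subst measure_distr) auto
      also have "\<dots> = measure (distr N borel ?S) (rough f k (2 * a))"
        using elim(3) by simp
      also have "\<dots> = N.prob (?S -` rough f k (2 * a) \<inter> space N)"
        by (subst measure_distr) auto
      also have "\<dots> \<le> N.prob (Z -` rough f k a \<inter> space N)"
        using stop_rough_imp_rough by (intro N.finite_measure_mono) auto
      finally have pR: "M.prob ?R < p" using k by linarith
      have "M.prob (A \<union> ?R) \<le> M.prob A + M.prob ?R"
        by (intro measure_Un_le) measurable
      then have "M.prob (A \<union> ?R) \<le> 2 * p" using pA pR by linarith
      then have 2: "2 * C * M.prob (A \<union> ?R) \<le> 2 * C * (2 * p)"
        using C(1) by (intro mult_left_mono) auto
      have "1 / real (Suc (Suc k)) < 1 / real (Suc k)" by (simp add: field_simps)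
      then have "\<bar>f (X i \<omega>) - f (Y k i \<omega>)\<bar> \<le> 2 * a" if "\<omega> \<in> space M" "\<omega> \<notin> A \<union> ?R" for \<omega>
        using that cl[of \<omega>] roughI[of "1 / real (Suc (Suc k))" k "2 * a" f "X i \<omega>" "Y k i \<omega>"]
        by (auto simp: not_less[symmetric] simp del: of_nat_Suc)
      then have 3: "\<bar>(\<integral>\<omega>. f (X i \<omega>) \<partial>M) - (\<integral>\<omega>. f (Y k i \<omega>) \<partial>M)\<bar> \<le> 2 * a + 2 * C * M.prob (A \<union> ?R)"
        using C(2) ap(1) by (intro M.integral_diff_le_off_small) auto
      have "(\<integral>\<omega>. f (Y k i \<omega>) \<partial>M) = (\<integral>w. f w \<partial>distr M borel (Y k i))"
        by (subst integral_distr) auto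
      also have "\<dots> = (\<integral>w. f w \<partial>distr N borel ?S)" using elim(3) by simp
      also have "\<dots> = (\<integral>\<omega>. f (?S \<omega>) \<partial>N)" by (subst integral_distr) auto
      finally have 4: "(\<integral>\<omega>. f (Y k i \<omega>) \<partial>M) = (\<integral>\<omega>. f (?S \<omega>) \<partial>N)" .
      have "2 * C * N.prob (Z -` rough f k a \<inter> space N) \<le> 2 * C * p"
        using C(1) k by (intro mult_left_mono) auto
      with 1 2 3 4 ap(3) show ?case unfolding dist_real_def by linarith
    qed
  qed
qed

section \<open>Brownian increments and the law of Brownian motion\<close>

lemma finite_grid:
  fixes S :: "real set"
  assumes "finite S" "0 \<in> S" "S \<subseteq> {0..}"
  obtains n :: nat and \<tau> :: "nat \<Rightarrow> real" where "\<tau> ` {..n} = S" "\<tau> 0 = 0"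
    "\<And>i j. i < j \<Longrightarrow> j \<le> n \<Longrightarrow> \<tau> i < \<tau> j"
proof -
  define xs where "xs = sorted_list_of_set S"
  define n where "n = length xs - 1"
  have xs: "set xs = S" "sorted_wrt (<) xs" "xs \<noteq> []"
    using assms unfolding xs_def by auto
  have len: "{..n} = {..<length xs}"
    using xs(3) unfolding n_def by (cases xs) auto
  have im: "(!) xs ` {..n} = S"
    unfolding len xs(1)[symmetric] by (auto simp: set_conv_nth)
  have less: "xs ! i < xs ! j" if "i < j" "j \<le> n" for i j
    using sorted_wrt_nth_less[OF xs(2) that(1)] that(2) len by auto
  obtain i where i: "i \<le> n" "xs ! i = 0"
    using im assms(2) by (metis atMost_iff imageE)
  have "xs ! 0 = 0"
  proof (cases "i = 0")
    case False
    then have "xs ! 0 < 0" using less[of 0 i] i by auto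
    moreover have "xs ! 0 \<in> S" using im by auto
    ultimately show ?thesis using assms(3) by auto
  qed (use i in simp)
  with im less show ?thesis using that[of "(!) xs" n] by blast
qed

context standard_brownian_motion
begin

lemma measurable_increment [measurable]:
  "0 \<le> s \<Longrightarrow> 0 \<le> t \<Longrightarrow> (\<lambda>\<omega>. W t \<omega> - W s \<omega>) \<in> borel_measurable M"
  using measurable_at[of s] measurable_at[of t] by measurable

text \<open>All end points are put on one grid.  Each increment is then the sum of the grid increments in a
  block of indices, and the blocks of different intervals are disjoint.\<close>

lemma indep_disjoint_increments:
  assumes "finite I" and st: "\<And>i. i \<in> I \<Longrightarrow> 0 \<le> s i \<and> s i < t i"
    and disj: "\<And>i j. i \<in> I \<Longrightarrow> j \<in> I \<Longrightarrow> i \<noteq> j \<Longrightarrow> t i \<le> s j \<or> t j \<le> s i"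
  shows "indep_vars (\<lambda>_. borel) (\<lambda>i \<omega>. W (t i) \<omega> - W (s i) \<omega>) I"
proof -
  have "insert 0 (s ` I \<union> t ` I) \<subseteq> {0..}" using st by force
  then obtain n :: nat and \<tau> :: "nat \<Rightarrow> real" where grid: "\<tau> ` {..n} = insert 0 (s ` I \<union> t ` I)" "\<tau> 0 = 0"
    "\<And>i j. i < j \<Longrightarrow> j \<le> n \<Longrightarrow> \<tau> i < \<tau> j"
    by (rule finite_grid[rotated 2]) (use assms(1) in simp_all)
  have "\<exists>p. p \<le> n \<and> \<tau> p = s i" "\<exists>q. q \<le> n \<and> \<tau> q = t i" if "i \<in> I" for i
  proof -
    have "s i \<in> \<tau> ` {..n}" "t i \<in> \<tau> ` {..n}" unfolding grid(1) using that by auto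
    then show "\<exists>p. p \<le> n \<and> \<tau> p = s i" "\<exists>q. q \<le> n \<and> \<tau> q = t i" by auto
  qed
  then obtain p q where p: "\<And>i. i \<in> I \<Longrightarrow> p i \<le> n \<and> \<tau> (p i) = s i"
    and q: "\<And>i. i \<in> I \<Longrightarrow> q i \<le> n \<and> \<tau> (q i) = t i"
    by metis
  have le: "i \<le> j" if "\<tau> i \<le> \<tau> j" "i \<le> n" for i j
    using that grid(3)[of j i] by (cases "i \<le> j") auto
  define K where "K i = {p i..<q i}" for i
  have pq: "p i \<le> q i" if "i \<in> I" for i
    using st[OF that] p[OF that] q[OF that] le[of "p i" "q i"] by simp
  have "disjoint_family_on K I"
    unfolding disjoint_family_on_def
  proof (intro ballI impI)
    fix i j assume ij: "i \<in> I" "j \<in> I" "i \<noteq> j"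
    have "q i \<le> p j \<or> q j \<le> p i"
      using disj[OF ij] p[OF ij(1)] p[OF ij(2)] q[OF ij(1)] q[OF ij(2)] le[of "q i" "p j"] le[of "q j" "p i"]
      by auto
    then show "K i \<inter> K j = {}" unfolding K_def by auto
  qed
  moreover have "indep_vars (\<lambda>_. borel) (\<lambda>i \<omega>. W (\<tau> (Suc i)) \<omega> - W (\<tau> i) \<omega>) {..<n}"
    using grid by (intro independent_increments) auto
  moreover have "K i \<subseteq> {..<n}" if "i \<in> I" for i
    using q[OF that] unfolding K_def by auto
  ultimately have "indep_vars (\<lambda>i. PiM (K i) (\<lambda>_. borel))
      (\<lambda>i \<omega>. \<lambda>m\<in>K i. W (\<tau> (Suc m)) \<omega> - W (\<tau> m) \<omega>) I"
    by (intro indep_vars_restrict) auto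
  then have "indep_vars (\<lambda>_. borel) (\<lambda>i \<omega>. (\<lambda>f. \<Sum>m\<in>K i. f m) (\<lambda>m\<in>K i. W (\<tau> (Suc m)) \<omega> - W (\<tau> m) \<omega>)) I"
    by (rule indep_vars_compose2) measurable
  moreover have "(\<Sum>m\<in>K i. (\<lambda>m\<in>K i. W (\<tau> (Suc m)) \<omega> - W (\<tau> m) \<omega>) m) = W (t i) \<omega> - W (s i) \<omega>"
    if "i \<in> I" for i \<omega>
    using sum_Suc_diff'[OF pq[OF that], of "\<lambda>m. W (\<tau> m) \<omega>"] p[OF that] q[OF that]
    unfolding K_def by simp
  ultimately show ?thesis
    by (simp cong: indep_vars_cong)
qed

text \<open>Here \<open>Z\<close> stands for the value at time \<open>a\<close>.  Keeping it as a separate variable that agrees with \<open>W a\<close> only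
  almost surely covers both the restart at \<open>a\<close> (\<open>Z = W a\<close>) and the pure scaling (\<open>a = 0\<close>, \<open>Z = 0\<close>).\<close>

lemma affine_brownian_motion:
  assumes "0 \<le> a" "0 < c" and Z: "Z \<in> borel_measurable M" and "AE \<omega> in M. W a \<omega> = Z \<omega>"
  shows "standard_brownian_motion M (\<lambda>t \<omega>. c * (W (a + t / c\<^sup>2) \<omega> - Z \<omega>))"
proof
  have nn: "0 \<le> a + t / c\<^sup>2" if "0 \<le> t" for t using that assms by simp
  show "random_variable borel (\<lambda>\<omega>. c * (W (a + t / c\<^sup>2) \<omega> - Z \<omega>))" if "0 \<le> t" for t
    using Z measurable_at[OF nn[OF that]] by measurable
  show "AE \<omega> in M. c * (W (a + 0 / c\<^sup>2) \<omega> - Z \<omega>) = 0"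
    using assms(4) by eventually_elim simp
  show "continuous_on {0..} (\<lambda>t. c * (W (a + t / c\<^sup>2) \<omega> - Z \<omega>))" if "\<omega> \<in> space M" for \<omega>
    using nn assms(2) by (intro continuous_intros continuous_on_compose2[OF continuous_paths[OF that]]) auto
  show "distributed M lborel (\<lambda>\<omega>. c * (W (a + t / c\<^sup>2) \<omega> - Z \<omega>) - c * (W (a + s / c\<^sup>2) \<omega> - Z \<omega>))
      (normal_density 0 (sqrt (t - s)))" if st: "0 \<le> s" "s < t" for s t
  proof -
    have lt: "a + s / c\<^sup>2 < a + t / c\<^sup>2"
      using st(2) assms(2) by (simp add: divide_strict_right_mono)
    have "distributed M lborel (\<lambda>\<omega>. 0 + c * (W (a + t / c\<^sup>2) \<omega> - W (a + s / c\<^sup>2) \<omega>))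
        (normal_density (0 + c * 0) (\<bar>c\<bar> * sqrt ((a + t / c\<^sup>2) - (a + s / c\<^sup>2))))"
      using lt assms(2)
      by (intro normal_density_affine normal_increments nn st(1)) auto
    moreover have "\<bar>c\<bar> * sqrt ((a + t / c\<^sup>2) - (a + s / c\<^sup>2)) = sqrt (t - s)"
    proof -
      have "(a + t / c\<^sup>2) - (a + s / c\<^sup>2) = (t - s) / c\<^sup>2" by (simp add: diff_divide_distrib)
      then show ?thesis using assms(2) by (simp add: real_sqrt_divide)
    qed
    ultimately show ?thesis by (simp add: algebra_simps)
  qed
  show "indep_vars (\<lambda>_. borel) (\<lambda>i \<omega>. c * (W (a + t (Suc i) / c\<^sup>2) \<omega> - Z \<omega>) - c * (W (a + t i / c\<^sup>2) \<omega> - Z \<omega>)) {..<n}"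
    if "0 \<le> t 0" "\<And>i. i < n \<Longrightarrow> t i < t (Suc i)" for n and t :: "nat \<Rightarrow> real"
  proof -
    have "indep_vars (\<lambda>_. borel) (\<lambda>i \<omega>. W (a + t (Suc i) / c\<^sup>2) \<omega> - W (a + t i / c\<^sup>2) \<omega>) {..<n}"
      using that nn assms(2)
      by (intro independent_increments[of "\<lambda>i. a + t i / c\<^sup>2"]) (auto simp: divide_strict_right_mono)
    then have "indep_vars (\<lambda>_. borel) (\<lambda>i \<omega>. c * (W (a + t (Suc i) / c\<^sup>2) \<omega> - W (a + t i / c\<^sup>2) \<omega>)) {..<n}"
      by (rule indep_vars_compose2) measurable
    then show ?thesis by (simp add: algebra_simps)
  qed
qed

lemma brownian_scaling:
  assumes "0 < c"
  shows "standard_brownian_motion M (\<lambda>t \<omega>. c * W (t / c\<^sup>2) \<omega>)"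
  using affine_brownian_motion[of 0 c "\<lambda>_. 0"] assms starts_at_0 by simp

lemma brownian_restart:
  assumes "0 \<le> a" "0 < c"
  shows "standard_brownian_motion M (\<lambda>t \<omega>. c * (W (a + t / c\<^sup>2) \<omega> - W a \<omega>))"
  using affine_brownian_motion[of a c "W a"] assms measurable_at by simp

lemma distr_increments:
  assumes "0 < n" "0 \<le> \<tau> 0" "\<And>i. i < n \<Longrightarrow> \<tau> i < \<tau> (Suc i)"
  shows "distr M (PiM {..<n} (\<lambda>_. borel)) (\<lambda>\<omega>. \<lambda>i\<in>{..<n}. W (\<tau> (Suc i)) \<omega> - W (\<tau> i) \<omega>) =
    PiM {..<n} (\<lambda>i. density lborel (normal_density 0 (sqrt (\<tau> (Suc i) - \<tau> i))))"
proof -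
  have nn: "0 \<le> \<tau> i" if "i \<le> n" for i
    using that
  proof (induction i)
    case (Suc i)
    then show ?case using assms(3)[of i] by simp
  qed (use assms in simp)
  have "distr M (PiM {..<n} (\<lambda>_. borel)) (\<lambda>\<omega>. \<lambda>i\<in>{..<n}. W (\<tau> (Suc i)) \<omega> - W (\<tau> i) \<omega>) =
      PiM {..<n} (\<lambda>i. distr M borel (\<lambda>\<omega>. W (\<tau> (Suc i)) \<omega> - W (\<tau> i) \<omega>))"
    using assms nn
    by (intro indep_vars_iff_distr_eq_PiM'[THEN iffD1] independent_increments) auto
  also have "\<dots> = PiM {..<n} (\<lambda>i. density lborel (normal_density 0 (sqrt (\<tau> (Suc i) - \<tau> i))))"
  proof (intro PiM_cong refl)
    fix i assume "i \<in> {..<n}"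
    then have "distr M lborel (\<lambda>\<omega>. W (\<tau> (Suc i)) \<omega> - W (\<tau> i) \<omega>) =
        density lborel (normal_density 0 (sqrt (\<tau> (Suc i) - \<tau> i)))"
      using assms nn by (intro distributed_distr_eq_density normal_increments) auto
    then show "distr M borel (\<lambda>\<omega>. W (\<tau> (Suc i)) \<omega> - W (\<tau> i) \<omega>) =
        density lborel (normal_density 0 (sqrt (\<tau> (Suc i) - \<tau> i)))"
      using distr_cong[of M M borel lborel] by (metis sets_lborel)
  qed
  finally show ?thesis .
qed

lemma measurable_path [measurable]:
  "(\<lambda>\<omega>. \<lambda>t\<in>{0..}. W t \<omega>) \<in> measurable M (PiM {0..} (\<lambda>_. borel))"
  using measurable_at by (intro measurable_restrict) auto

text \<open>Since \<open>W\<close> starts at \<open>0\<close>, its value at a grid time is almost surely the sum of the preceding grid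
  increments; this turns a cylinder event into an event for independent normal variables.\<close>

lemma emeasure_cylinder_eq_increments:
  assumes "\<tau> 0 = 0" "\<And>i j. i < j \<Longrightarrow> j \<le> n \<Longrightarrow> \<tau> i < \<tau> j" "finite J"
    and m: "\<And>t. t \<in> J \<Longrightarrow> m t \<le> n \<and> \<tau> (m t) = t"
    and A: "\<And>t. t \<in> J \<Longrightarrow> A t \<in> sets borel"
  shows "emeasure (distr M (PiM {0..} (\<lambda>_. borel)) (\<lambda>\<omega>. \<lambda>t\<in>{0..}. W t \<omega>))
      (prod_emb {0..} (\<lambda>_. borel) J (Pi\<^sub>E J A)) =
    emeasure (distr M (PiM {..<n} (\<lambda>_. borel)) (\<lambda>\<omega>. \<lambda>i\<in>{..<n}. W (\<tau> (Suc i)) \<omega> - W (\<tau> i) \<omega>))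
      {x \<in> space (PiM {..<n} (\<lambda>_. borel)). \<forall>t\<in>J. (\<Sum>i<m t. x i) \<in> A t}"
    (is "emeasure ?L ?E = emeasure ?R ?B")
proof -
  have nn: "0 \<le> \<tau> i" if "i \<le> n" for i
    using assms(1) assms(2)[of 0 i] that by (cases "i = 0") auto
  have J: "J \<subseteq> {0..}" using m nn by (metis atLeast_iff subsetI)
  have E: "?E \<in> sets (PiM {0..} (\<lambda>_. borel))"
    using assms(3) J A by (intro sets_PiM_I) auto
  have B: "?B \<in> sets (PiM {..<n} (\<lambda>_. borel))"
  proof -
    have "(\<lambda>x. \<Sum>i<m t. x i) \<in> measurable (PiM {..<n} (\<lambda>_. borel)) (borel :: real measure)" if "t \<in> J" for t
      using m[OF that] by (intro borel_measurable_sum measurable_component_singleton) auto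
    then have "{x \<in> space (PiM {..<n} (\<lambda>_. borel)). (\<Sum>i<m t. x i) \<in> A t} \<in> sets (PiM {..<n} (\<lambda>_. borel))"
      if "t \<in> J" for t
      using measurable_sets_Collect[of _ "PiM {..<n} (\<lambda>_. borel)" borel "\<lambda>y. y \<in> A t"] A that by simp
    then show ?thesis
      using assms(3) by (intro sets.sets_Collect_finite_All) auto
  qed
  have inc: "(\<lambda>\<omega>. \<lambda>i\<in>{..<n}. W (\<tau> (Suc i)) \<omega> - W (\<tau> i) \<omega>) \<in> measurable M (PiM {..<n} (\<lambda>_. borel))"
    using nn by (intro measurable_restrict measurable_increment) auto
  have "emeasure ?L ?E = emeasure M ((\<lambda>\<omega>. \<lambda>t\<in>{0..}. W t \<omega>) -` ?E \<inter> space M)"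
    using E by (intro emeasure_distr) measurable
  also have "\<dots> = emeasure M ((\<lambda>\<omega>. \<lambda>i\<in>{..<n}. W (\<tau> (Suc i)) \<omega> - W (\<tau> i) \<omega>) -` ?B \<inter> space M)"
  proof (rule emeasure_eq_AE)
    show "AE \<omega> in M. \<omega> \<in> (\<lambda>\<omega>. \<lambda>t\<in>{0..}. W t \<omega>) -` ?E \<inter> space M \<longleftrightarrow>
        \<omega> \<in> (\<lambda>\<omega>. \<lambda>i\<in>{..<n}. W (\<tau> (Suc i)) \<omega> - W (\<tau> i) \<omega>) -` ?B \<inter> space M"
      using starts_at_0
    proof eventually_elim
      case (elim \<omega>)
      have "(\<Sum>i<m t. (\<lambda>i\<in>{..<n}. W (\<tau> (Suc i)) \<omega> - W (\<tau> i) \<omega>) i) = W t \<omega>" if "t \<in> J" for t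
      proof -
        have "(\<Sum>i<m t. (\<lambda>i\<in>{..<n}. W (\<tau> (Suc i)) \<omega> - W (\<tau> i) \<omega>) i) =
            (\<Sum>i<m t. W (\<tau> (Suc i)) \<omega> - W (\<tau> i) \<omega>)"
          using m[OF that] by (intro sum.cong) auto
        also have "\<dots> = W t \<omega>"
          using sum_lessThan_telescope[of "\<lambda>i. W (\<tau> i) \<omega>" "m t"] m[OF that] assms(1) elim by simp
        finally show ?thesis .
      qed
      moreover have "(\<lambda>t\<in>{0..}. W t \<omega>) \<in> ?E \<longleftrightarrow> (\<forall>t\<in>J. W t \<omega> \<in> A t)"
        using J by (auto simp: prod_emb_def space_PiM PiE_iff)
      moreover have "(\<lambda>i\<in>{..<n}. W (\<tau> (Suc i)) \<omega> - W (\<tau> i) \<omega>) \<in> space (PiM {..<n} (\<lambda>_. borel))"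
        by (simp add: space_PiM)
      ultimately show ?case by auto
    qed
  qed (rule measurable_sets[OF measurable_path E] measurable_sets[OF inc B])+
  also have "\<dots> = emeasure ?R ?B"
    using B inc by (intro emeasure_distr[symmetric])
  finally show ?thesis .
qed

end

lemma brownian_law_unique:
  assumes "standard_brownian_motion M W" "standard_brownian_motion N V"
  shows "distr M (PiM {0..} (\<lambda>_. borel)) (\<lambda>\<omega>. \<lambda>t\<in>{0..}. W t \<omega>) =
    distr N (PiM {0..} (\<lambda>_. borel)) (\<lambda>\<omega>. \<lambda>t\<in>{0..}. V t \<omega>)"
proof (rule measure_eqI_PiM_infinite)
  interpret M: standard_brownian_motion M W by fact
  interpret N: standard_brownian_motion N V by fact
  interpret D: prob_space "distr M (PiM {0..} (\<lambda>_. borel)) (\<lambda>\<omega>. \<lambda>t\<in>{0..}. W t \<omega>)"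
    by (intro M.prob_space_distr) measurable
  show "finite_measure (distr M (PiM {0..} (\<lambda>_. borel)) (\<lambda>\<omega>. \<lambda>t\<in>{0..}. W t \<omega>))"
    by unfold_locales
  fix A :: "real \<Rightarrow> real set" and J :: "real set"
  assume J: "finite J" "J \<subseteq> {0..}" and A: "\<And>t. t \<in> J \<Longrightarrow> A t \<in> sets borel"
  obtain n :: nat and \<tau> :: "nat \<Rightarrow> real" where grid: "\<tau> ` {..n} = insert 0 (insert 1 J)" "\<tau> 0 = 0"
    "\<And>i j. i < j \<Longrightarrow> j \<le> n \<Longrightarrow> \<tau> i < \<tau> j"
    by (rule finite_grid[of "insert 0 (insert 1 J)"]) (use J in auto)
  have "n \<noteq> 0"
  proof
    assume "n = 0"
    then have "1 \<in> \<tau> ` {0}" using grid(1) by auto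
    with grid(2) show False by auto
  qed
  have "\<exists>i. i \<le> n \<and> \<tau> i = t" if "t \<in> J" for t
  proof -
    have "t \<in> \<tau> ` {..n}" unfolding grid(1) using that by simp
    then show ?thesis by auto
  qed
  then obtain m where m: "\<And>t. t \<in> J \<Longrightarrow> m t \<le> n \<and> \<tau> (m t) = t" by metis
  show "emeasure (distr M (PiM {0..} (\<lambda>_. borel)) (\<lambda>\<omega>. \<lambda>t\<in>{0..}. W t \<omega>))
        (prod_emb {0..} (\<lambda>_. borel) J (Pi\<^sub>E J A)) =
      emeasure (distr N (PiM {0..} (\<lambda>_. borel)) (\<lambda>\<omega>. \<lambda>t\<in>{0..}. V t \<omega>))
        (prod_emb {0..} (\<lambda>_. borel) J (Pi\<^sub>E J A))"
    using grid(3) \<open>n \<noteq> 0\<close>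
    by (simp add: M.emeasure_cylinder_eq_increments[OF grid(2,3) J(1) m A]
        N.emeasure_cylinder_eq_increments[OF grid(2,3) J(1) m A] M.distr_increments N.distr_increments grid(2))
qed auto

section \<open>Independence of time-separated blocks\<close>

text \<open>Cylinder events form a generator of the product sigma-algebra that is stable under intersection,
  and finitely many cylinders share one finite set of times.\<close>

lemma (in prob_space) indep_vars_processI:
  fixes Z :: "'j \<Rightarrow> 't \<Rightarrow> 'a \<Rightarrow> 'b::topological_space"
  assumes Z: "\<And>j t. j \<in> I \<Longrightarrow> t \<in> T \<Longrightarrow> Z j t \<in> borel_measurable M" and "finite I" "T \<noteq> {}"
    and fin: "\<And>F. finite F \<Longrightarrow> F \<noteq> {} \<Longrightarrow> F \<subseteq> T \<Longrightarrow>
      indep_vars (\<lambda>_. PiM F (\<lambda>_. borel)) (\<lambda>j \<omega>. \<lambda>t\<in>F. Z j t \<omega>) I"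
  shows "indep_vars (\<lambda>_. PiM T (\<lambda>_. borel)) (\<lambda>j \<omega>. \<lambda>t\<in>T. Z j t \<omega>) I"
  unfolding indep_vars_def2
proof (intro conjI ballI)
  let ?X = "\<lambda>j \<omega>. \<lambda>t\<in>T. Z j t \<omega>"
  let ?A = "prod_algebra T (\<lambda>_. borel :: 'b measure)"
  have X: "?X j \<in> measurable M (PiM T (\<lambda>_. borel))" if "j \<in> I" for j
    using Z that by (intro measurable_restrict) auto
  then show "random_variable (PiM T (\<lambda>_. borel)) (?X j)" if "j \<in> I" for j
    using that .
  define G where "G j = {?X j -` A \<inter> space M | A. A \<in> ?A}" for j
  have sigma: "{?X j -` A \<inter> space M | A. A \<in> sets (PiM T (\<lambda>_. borel))} = sigma_sets (space M) (G j)" if "j \<in> I" for j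
    unfolding sets_PiM G_def
    by (rule sigma_sets_vimage_commute) (auto simp: PiE_def)
  have "indep_sets G I"
  proof (rule indep_setsI)
    fix j assume "j \<in> I"
    have "?A \<subseteq> sets (PiM T (\<lambda>_. borel))" unfolding sets_PiM by auto
    then show "G j \<subseteq> events"
      unfolding G_def using measurable_sets[OF X[OF \<open>j \<in> I\<close>]] by blast
  next
    fix B J assume J: "J \<noteq> {}" "J \<subseteq> I" "finite J" and B: "\<forall>j\<in>J. B j \<in> G j"
    define Q where "Q j F E \<longleftrightarrow> finite F \<and> F \<subseteq> T \<and> (\<forall>t\<in>F. E t \<in> sets (borel :: 'b measure)) \<and>
        B j = {\<omega> \<in> space M. \<forall>t\<in>F. Z j t \<omega> \<in> E t}" for j F E
    have "\<exists>F E. Q j F E" if j: "j \<in> J" for j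
    proof -
      have "\<exists>A. B j = ?X j -` A \<inter> space M \<and> A \<in> ?A"
        using bspec[OF B j] unfolding G_def by (rule CollectD)
      then obtain A where "A \<in> ?A" and BA: "B j = ?X j -` A \<inter> space M"
        by (elim exE conjE)
      then obtain F E where FE: "A = prod_emb T (\<lambda>_. borel) F (Pi\<^sub>E F E)" "finite F" "F \<subseteq> T"
        "\<And>t. t \<in> F \<Longrightarrow> E t \<in> sets (borel :: 'b measure)"
        by (metis prod_algebraE)
      have "B j = {\<omega> \<in> space M. \<forall>t\<in>F. Z j t \<omega> \<in> E t}"
        unfolding BA FE(1) using FE(3) by (auto simp: prod_emb_def PiE_iff subset_eq)
      with FE(2-4) show ?thesis unfolding Q_def by blast
    qed
    then obtain F E where "\<And>j. j \<in> J \<Longrightarrow> Q j (F j) (E j)" by metis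
    then have F: "\<And>j. j \<in> J \<Longrightarrow> finite (F j) \<and> F j \<subseteq> T"
      and E: "\<And>j t. j \<in> J \<Longrightarrow> t \<in> F j \<Longrightarrow> E j t \<in> sets (borel :: 'b measure)"
      and BE: "\<And>j. j \<in> J \<Longrightarrow> B j = {\<omega> \<in> space M. \<forall>t\<in>F j. Z j t \<omega> \<in> E j t}"
      unfolding Q_def by auto
    obtain t0 where t0: "t0 \<in> T" using assms(3) by blast
    define H where "H = insert t0 (\<Union>j\<in>J. F j)"
    have H: "finite H" "H \<noteq> {}" "H \<subseteq> T" unfolding H_def using F J t0 by auto
    define C where "C j = prod_emb H (\<lambda>_. borel) (F j) (Pi\<^sub>E (F j) (E j))" for j
    have FH: "F j \<subseteq> H" if "j \<in> J" for j using that unfolding H_def by auto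
    have BC: "B j = (\<lambda>\<omega>. \<lambda>t\<in>H. Z j t \<omega>) -` C j \<inter> space M" if "j \<in> J" for j
      unfolding BE[OF that] C_def using FH[OF that] by (auto simp: prod_emb_def PiE_iff subset_eq)
    have C: "C j \<in> sets (PiM H (\<lambda>_. borel))" if "j \<in> J" for j
      unfolding C_def using F FH E that by (intro sets_PiM_I) auto
    have "prob (\<Inter>j\<in>J. (\<lambda>\<omega>. \<lambda>t\<in>H. Z j t \<omega>) -` C j \<inter> space M) =
        (\<Prod>j\<in>J. prob ((\<lambda>\<omega>. \<lambda>t\<in>H. Z j t \<omega>) -` C j \<inter> space M))"
      by (rule indep_varsD[OF fin[OF H]]) (use J C in auto)
    then show "prob (\<Inter> (B ` J)) = (\<Prod>j\<in>J. prob (B j))"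
      using BC by simp
  qed
  moreover have "Int_stable (G j)" for j
  proof (rule Int_stableI)
    fix a b assume "a \<in> G j" "b \<in> G j"
    then obtain A B where "A \<in> ?A" "B \<in> ?A" "a = ?X j -` A \<inter> space M" "b = ?X j -` B \<inter> space M"
      unfolding G_def by auto
    moreover have "A \<inter> B \<in> ?A"
      using Int_stable_prod_algebra \<open>A \<in> ?A\<close> \<open>B \<in> ?A\<close> unfolding Int_stable_def by blast
    ultimately show "a \<inter> b \<in> G j" unfolding G_def by (auto intro!: exI[of _ "A \<inter> B"])
  qed
  ultimately have "indep_sets (\<lambda>j. sigma_sets (space M) (G j)) I"
    by (rule indep_sets_sigma)
  then show "indep_sets (\<lambda>j. {?X j -` A \<inter> space M | A. A \<in> sets (PiM T (\<lambda>_. borel))}) I"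
    using sigma by (simp cong: indep_sets_cong)
qed

context standard_brownian_motion
begin

text \<open>By the previous criterion it suffices to look at finitely many times.  On a grid the block
  processes are partial sums of increments of \<open>W\<close>, and all these increments, over all blocks, belong to
  disjoint intervals.\<close>

lemma indep_blocks:
  fixes a c :: "'j \<Rightarrow> real"
  assumes "finite I" "0 < K" and a: "\<And>j. j \<in> I \<Longrightarrow> 0 \<le> a j" and c: "\<And>j. j \<in> I \<Longrightarrow> 0 < c j"
    and disj: "\<And>i j. i \<in> I \<Longrightarrow> j \<in> I \<Longrightarrow> i \<noteq> j \<Longrightarrow>
      a i + K / (c i)\<^sup>2 \<le> a j \<or> a j + K / (c j)\<^sup>2 \<le> a i"
  shows "indep_vars (\<lambda>_. PiM {0..K} (\<lambda>_. borel))
    (\<lambda>j \<omega>. \<lambda>t\<in>{0..K}. c j * (W (a j + t / (c j)\<^sup>2) \<omega> - W (a j) \<omega>)) I"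
proof (rule indep_vars_processI)
  show "(\<lambda>\<omega>. c j * (W (a j + t / (c j)\<^sup>2) \<omega> - W (a j) \<omega>)) \<in> borel_measurable M"
    if "j \<in> I" "t \<in> {0..K}" for j t
    using a[OF that(1)] that(2) by (intro borel_measurable_times measurable_increment) auto
  fix F assume F: "finite F" "F \<subseteq> {0..K}"
  obtain n :: nat and \<tau> :: "nat \<Rightarrow> real" where grid: "\<tau> ` {..n} = insert 0 F" "\<tau> 0 = 0"
    "\<And>i j. i < j \<Longrightarrow> j \<le> n \<Longrightarrow> \<tau> i < \<tau> j"
    by (rule finite_grid[of "insert 0 F"]) (use F in auto)
  have \<tau>: "0 \<le> \<tau> i \<and> \<tau> i \<le> K" if "i \<le> n" for i
  proof -
    have "\<tau> i \<in> insert 0 F" unfolding grid(1)[symmetric] using that by simp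
    then show ?thesis using F(2) assms(2) by auto
  qed
  have "\<exists>i. i \<le> n \<and> \<tau> i = t" if "t \<in> F" for t
  proof -
    have "t \<in> \<tau> ` {..n}" unfolding grid(1) using that by simp
    then show ?thesis by auto
  qed
  then obtain m where m: "\<And>t. t \<in> F \<Longrightarrow> m t \<le> n \<and> \<tau> (m t) = t" by metis
  let ?u = "\<lambda>j i. a j + \<tau> i / (c j)\<^sup>2"
  have u_le: "?u j i \<le> ?u j i'" if "j \<in> I" "i \<le> i'" "i' \<le> n" for j i i'
    using grid(3)[of i i'] c[OF that(1)] that by (cases "i = i'") (auto simp: divide_right_mono)
  have u_end: "?u j i \<le> a j + K / (c j)\<^sup>2" "a j \<le> ?u j i" if "j \<in> I" "i \<le> n" for j i
    using \<tau>[OF that(2)] c[OF that(1)] by (auto simp: divide_right_mono)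
  have "indep_vars (\<lambda>_. borel) (\<lambda>(j, i) \<omega>. W (?u j (Suc i)) \<omega> - W (?u j i) \<omega>) (I \<times> {..<n})"
  proof -
    have "indep_vars (\<lambda>_. borel) (\<lambda>x \<omega>. W (?u (fst x) (Suc (snd x))) \<omega> - W (?u (fst x) (snd x)) \<omega>) (I \<times> {..<n})"
    proof (rule indep_disjoint_increments)
      fix x assume "x \<in> I \<times> {..<n}"
      then show "0 \<le> ?u (fst x) (snd x) \<and> ?u (fst x) (snd x) < ?u (fst x) (Suc (snd x))"
        using a[of "fst x"] c[of "fst x"] \<tau>[of "snd x"] grid(3)[of "snd x" "Suc (snd x)"]
        by (auto simp: divide_strict_right_mono)
    next
      fix x y assume "x \<in> I \<times> {..<n}" "y \<in> I \<times> {..<n}" "x \<noteq> y"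
      then obtain j i j' i' where xy: "x = (j, i)" "y = (j', i')" "j \<in> I" "j' \<in> I" "i < n" "i' < n"
        "j \<noteq> j' \<or> i \<noteq> i'" by (cases x; cases y) auto
      show "?u (fst x) (Suc (snd x)) \<le> ?u (fst y) (snd y) \<or> ?u (fst y) (Suc (snd y)) \<le> ?u (fst x) (snd x)"
      proof (cases "j = j'")
        case True
        then show ?thesis
          using xy u_le[of j "Suc i" i'] u_le[of j "Suc i'" i] by (cases "i < i'") auto
      next
        case False
        then show ?thesis
          using disj[OF xy(3,4) False] xy u_end[of j "Suc i"] u_end[of j i] u_end[of j' i'] u_end[of j' "Suc i'"]
          by auto
      qed
    qed (use assms in auto)
    then show ?thesis by (simp add: case_prod_beta')
  qed
  then have "indep_vars (\<lambda>j. PiM ({j} \<times> {..<n}) (\<lambda>_. borel))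
      (\<lambda>j \<omega>. \<lambda>x\<in>{j} \<times> {..<n}. (case x of (j, i) \<Rightarrow> \<lambda>\<omega>. W (?u j (Suc i)) \<omega> - W (?u j i) \<omega>) \<omega>) I"
    by (rule indep_vars_restrict) (auto simp: disjoint_family_on_def)
  then have "indep_vars (\<lambda>_. PiM F (\<lambda>_. borel))
      (\<lambda>j \<omega>. (\<lambda>f. \<lambda>t\<in>F. c j * (\<Sum>i<m t. f (j, i)))
        (\<lambda>x\<in>{j} \<times> {..<n}. (case x of (j, i) \<Rightarrow> \<lambda>\<omega>. W (?u j (Suc i)) \<omega> - W (?u j i) \<omega>) \<omega>)) I"
  proof (rule indep_vars_compose2)
    fix j
    show "(\<lambda>f. \<lambda>t\<in>F. c j * (\<Sum>i<m t. f (j, i))) \<in> measurable (PiM ({j} \<times> {..<n}) (\<lambda>_. borel)) (PiM F (\<lambda>_. borel))"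
    proof (intro measurable_restrict borel_measurable_times borel_measurable_const borel_measurable_sum
        measurable_component_singleton)
      fix t i assume "t \<in> F" "i \<in> {..<m t}"
      then show "(j, i) \<in> {j} \<times> {..<n}" using m[of t] by auto
    qed
  qed
  moreover have "(\<lambda>t\<in>F. c j * (\<Sum>i<m t. (\<lambda>x\<in>{j} \<times> {..<n}. (case x of (j, i) \<Rightarrow> \<lambda>\<omega>. W (?u j (Suc i)) \<omega> - W (?u j i) \<omega>) \<omega>) (j, i))) =
      (\<lambda>t\<in>F. c j * (W (a j + t / (c j)\<^sup>2) \<omega> - W (a j) \<omega>))" for j \<omega>
  proof (intro restrict_ext arg_cong[of _ _ "(*) (c j)"])
    fix t assume t: "t \<in> F"
    have "(\<Sum>i<m t. (\<lambda>x\<in>{j} \<times> {..<n}. (case x of (j, i) \<Rightarrow> \<lambda>\<omega>. W (?u j (Suc i)) \<omega> - W (?u j i) \<omega>) \<omega>) (j, i)) =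
        (\<Sum>i<m t. W (?u j (Suc i)) \<omega> - W (?u j i) \<omega>)"
      using m[OF t] by (intro sum.cong) auto
    also have "\<dots> = W (a j + t / (c j)\<^sup>2) \<omega> - W (a j) \<omega>"
      using sum_lessThan_telescope[of "\<lambda>i. W (?u j i) \<omega>" "m t"] m[OF t] grid(2) by simp
    finally show "(\<Sum>i<m t. (\<lambda>x\<in>{j} \<times> {..<n}. (case x of (j, i) \<Rightarrow> \<lambda>\<omega>. W (?u j (Suc i)) \<omega> - W (?u j i) \<omega>) \<omega>) (j, i)) =
      W (a j + t / (c j)\<^sup>2) \<omega> - W (a j) \<omega>" .
  qed
  ultimately show "indep_vars (\<lambda>_. PiM F (\<lambda>_. borel))
      (\<lambda>j \<omega>. \<lambda>t\<in>F. c j * (W (a j + t / (c j)\<^sup>2) \<omega> - W (a j) \<omega>)) I"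
    by simp
qed (use assms in auto)

section \<open>Small time shifts of Brownian motion\<close>

text \<open>The exceptional set \<open>E\<close> is a set of paths, not of points of the sample space, so that its
  probability is the same for every Brownian motion; this makes \<open>h\<close> uniform in the scaling
  parameter.  It has small probability for small \<open>h\<close> because paths are uniformly continuous on
  compact intervals and start at \<open>0\<close>.  Restricting to rational times makes it measurable.\<close>

lemma small_shift_oscillation:
  assumes "0 < K" "0 < d" "0 < e"
  obtains h E where "0 < h" "E \<in> sets (PiM {0..} (\<lambda>_. borel))"
    "prob ((\<lambda>\<omega>. \<lambda>t\<in>{0..}. W t \<omega>) -` E \<inter> space M) < e"
    "\<And>x t s. continuous_on {0..} x \<Longrightarrow> (\<lambda>t\<in>{0..}. x t) \<notin> E \<Longrightarrow> t \<in> {0..K} \<Longrightarrow> s \<in> {0..h} \<Longrightarrow>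
      \<bar>x t - (x (s + t) - x s)\<bar> \<le> d"
proof -
  let ?P = "PiM {0..} (\<lambda>_. borel) :: (real \<Rightarrow> real) measure"
  define E where "E n = {x \<in> space ?P. \<exists>t\<in>{0..K} \<inter> \<rat>. \<exists>s\<in>{0..1 / real (Suc n)} \<inter> \<rat>.
      d < \<bar>x t - (x (s + t) - x s)\<bar>}" for n
  have E_sets: "E n \<in> sets ?P" for n
  proof -
    have cnt: "countable ({0..K} \<inter> \<rat>)" "countable ({0..1 / real (Suc n)} \<inter> \<rat>)"
      using countable_rat by blast+
    have one: "{x \<in> space ?P. d < \<bar>x t - (x (s + t) - x s)\<bar>} \<in> sets ?P" if "0 \<le> t" "0 \<le> s" for t s
    proof -
      have "(\<lambda>x. \<bar>x t - (x (s + t) - x s)\<bar>) \<in> borel_measurable ?P"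
        using that by (intro borel_measurable_abs borel_measurable_diff measurable_component_singleton) auto
      then show ?thesis by measurable
    qed
    show ?thesis
      unfolding E_def by (intro sets.sets_Collect_countable_Ex' cnt one) auto
  qed
  let ?X = "\<lambda>\<omega>. \<lambda>t\<in>{0..}. W t \<omega>"
  have "decseq (\<lambda>n. ?X -` E n \<inter> space M)"
  proof (rule decseq_SucI)
    fix n
    have "{0..1 / real (Suc (Suc n))} \<subseteq> {0..1 / real (Suc n)}" by (auto simp: field_simps)
    then have "E (Suc n) \<subseteq> E n" unfolding E_def by blast
    then show "?X -` E (Suc n) \<inter> space M \<subseteq> ?X -` E n \<inter> space M" by blast
  qed
  then have "(\<lambda>n. prob (?X -` E n \<inter> space M)) \<longlonglongrightarrow> prob (\<Inter>n. ?X -` E n \<inter> space M)"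
    using measurable_sets[OF measurable_path E_sets] by (intro finite_Lim_measure_decseq) auto
  moreover have "AE \<omega> in M. \<omega> \<notin> (\<Inter>n. ?X -` E n \<inter> space M)"
    using starts_at_0 AE_space
  proof eventually_elim
    case (elim \<omega>)
    have "uniformly_continuous_on {0..K + 1} (\<lambda>t. W t \<omega>)"
      by (intro compact_uniformly_continuous continuous_on_subset[OF continuous_paths[OF elim(2)]]) auto
    then obtain r where r: "r > 0" "\<And>s t. s \<in> {0..K + 1} \<Longrightarrow> t \<in> {0..K + 1} \<Longrightarrow> dist t s < r \<Longrightarrow>
        dist (W t \<omega>) (W s \<omega>) < d / 2"
      using assms(2) unfolding uniformly_continuous_on_def by (metis half_gt_zero)
    obtain n where n: "1 / real (Suc n) < r"
      using reals_Archimedean[OF r(1)] by (auto simp: field_simps)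
    have "\<bar>W t \<omega> - (W (s + t) \<omega> - W s \<omega>)\<bar> \<le> d" if t: "t \<in> {0..K}" and s: "s \<in> {0..1 / real (Suc n)}" for t s
    proof -
      have "1 / real (Suc n) \<le> 1" by simp
      moreover have "0 \<le> s" "s \<le> 1 / real (Suc n)" using s by auto
      ultimately have s1: "0 \<le> s" "s \<le> 1" "s < r" using n by linarith+
      have "dist (W s \<omega>) (W 0 \<omega>) < d / 2"
        using s1 assms(1) by (intro r(2)) (auto simp: dist_real_def)
      moreover have "dist (W (s + t) \<omega>) (W t \<omega>) < d / 2"
        using s1 t assms(1) by (intro r(2)) (auto simp: dist_real_def)
      ultimately show ?thesis using elim(1) unfolding dist_real_def by linarith
    qed
    then have "?X \<omega> \<notin> E n" unfolding E_def by (force simp: not_less)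
    then show ?case by blast
  qed
  moreover have "(\<Inter>n. ?X -` E n \<inter> space M) \<in> events"
    using measurable_sets[OF measurable_path E_sets] by (intro sets.countable_INT) auto
  ultimately have "(\<lambda>n. prob (?X -` E n \<inter> space M)) \<longlonglongrightarrow> 0"
    using prob_eq_0 by metis
  then have "\<forall>\<^sub>F n in sequentially. prob (?X -` E n \<inter> space M) < e"
    using assms(3) by (simp add: order_tendstoD(2))
  then obtain n where n: "prob (?X -` E n \<inter> space M) < e"
    using eventually_happens by fastforce
  have "\<bar>x t - (x (s + t) - x s)\<bar> \<le> d"
    if x: "continuous_on {0..} x" "(\<lambda>t\<in>{0..}. x t) \<notin> E n" and t: "t \<in> {0..K}" and s: "s \<in> {0..1 / real (Suc n)}" for x t s
  proof -
    have rat: "\<bar>x t - (x (s + t) - x s)\<bar> \<le> d"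
      if "t \<in> {0..K}" "s \<in> {0..1 / real (Suc n)}" "t \<in> \<rat>" "s \<in> \<rat>" for t s
    proof (rule ccontr)
      assume "\<not> ?thesis"
      then have "\<exists>s\<in>{0..1 / real (Suc n)} \<inter> \<rat>. d < \<bar>x t - (x (s + t) - x s)\<bar>"
        using that by (intro bexI[of _ s]) auto
      then have "\<exists>t\<in>{0..K} \<inter> \<rat>. \<exists>s\<in>{0..1 / real (Suc n)} \<inter> \<rat>. d < \<bar>x t - (x (s + t) - x s)\<bar>"
        using that by blast
      then have "(\<lambda>t\<in>{0..}. x t) \<in> E n"
        unfolding E_def by (auto simp: space_PiM)
      with x(2) show False ..
    qed
    have rat_s: "\<bar>x t - (x (s + t) - x s)\<bar> \<le> d" if s: "s \<in> {0..1 / real (Suc n)}" "s \<in> \<rat>" for s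
    proof (rule continuous_le_on_Rats[of 0 K "\<lambda>t. \<bar>x t - (x (s + t) - x s)\<bar>"])
      show "continuous_on {0..K} (\<lambda>t. \<bar>x t - (x (s + t) - x s)\<bar>)"
        using s by (intro continuous_intros continuous_on_compose2[OF x(1)]) auto
    qed (use assms t rat s in auto)
    show ?thesis
    proof (rule continuous_le_on_Rats[of 0 "1 / real (Suc n)" "\<lambda>s. \<bar>x t - (x (s + t) - x s)\<bar>"])
      show "continuous_on {0..1 / real (Suc n)} (\<lambda>s. \<bar>x t - (x (s + t) - x s)\<bar>)"
        using t by (intro continuous_intros continuous_on_compose2[OF x(1)]) auto
    qed (use s rat_s in auto)
  qed
  then show ?thesis using that[of "1 / real (Suc n)" "E n"] E_sets n by simp
qed

end

section \<open>Convergence of the rescaled Brownian motions\<close>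

lemma borel_measurable_vec_lambda:
  fixes f :: "'j::finite \<Rightarrow> 'w \<Rightarrow> real"
  assumes "\<And>j. f j \<in> borel_measurable M"
  shows "(\<lambda>\<omega>. \<chi> j. f j \<omega>) \<in> borel_measurable M"
proof (rule borel_measurable_euclidean_space[THEN iffD2], rule)
  fix b :: "real ^ 'j" assume "b \<in> Basis"
  then obtain j where "b = axis j 1" by (auto simp: Basis_vec_def)
  then show "(\<lambda>\<omega>. (\<chi> j. f j \<omega>) \<bullet> b) \<in> borel_measurable M"
    using assms[of j] by (simp add: inner_axis)
qed

text \<open>The joint law of independent coordinate processes is the product of their laws, and the
  vector-valued path is a measurable function of the family of coordinate paths.\<close>

lemma distr_vec_path_eqI:
  fixes X :: "'j::finite \<Rightarrow> real \<Rightarrow> 'w \<Rightarrow> real" and Y :: "'j \<Rightarrow> real \<Rightarrow> 'v \<Rightarrow> real"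
  assumes M: "prob_space M" and N: "prob_space N"
    and X: "prob_space.indep_vars M (\<lambda>_. PiM {0..} (\<lambda>_. borel)) (\<lambda>j \<omega>. \<lambda>t\<in>{0..}. X j t \<omega>) UNIV"
    and Y: "prob_space.indep_vars N (\<lambda>_. PiM {0..} (\<lambda>_. borel)) (\<lambda>j \<omega>. \<lambda>t\<in>{0..}. Y j t \<omega>) UNIV"
    and eq: "\<And>j. distr M (PiM {0..} (\<lambda>_. borel)) (\<lambda>\<omega>. \<lambda>t\<in>{0..}. X j t \<omega>) =
      distr N (PiM {0..} (\<lambda>_. borel)) (\<lambda>\<omega>. \<lambda>t\<in>{0..}. Y j t \<omega>)"
  shows "distr M (PiM {0..} (\<lambda>_. borel)) (\<lambda>\<omega>. \<lambda>t\<in>{0..}. \<chi> j. X j t \<omega>) =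
    distr N (PiM {0..} (\<lambda>_. borel)) (\<lambda>\<omega>. \<lambda>t\<in>{0..}. \<chi> j. Y j t \<omega>)"
proof -
  let ?P = "PiM {0..} (\<lambda>_. borel) :: (real \<Rightarrow> real) measure"
  let ?Q = "PiM UNIV (\<lambda>_. ?P) :: ('j \<Rightarrow> real \<Rightarrow> real) measure"
  let ?JX = "\<lambda>\<omega>. \<lambda>j\<in>UNIV. \<lambda>t\<in>{0..}. X j t \<omega>" and ?JY = "\<lambda>\<omega>. \<lambda>j\<in>UNIV. \<lambda>t\<in>{0..}. Y j t \<omega>"
  define G :: "('j \<Rightarrow> real \<Rightarrow> real) \<Rightarrow> real \<Rightarrow> real ^ 'j" where "G x = (\<lambda>t\<in>{0..}. \<chi> j. x j t)" for x
  have rX: "(\<lambda>\<omega>. \<lambda>t\<in>{0..}. X j t \<omega>) \<in> measurable M ?P" for j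
    using X unfolding prob_space.indep_vars_def2[OF M] by simp
  have rY: "(\<lambda>\<omega>. \<lambda>t\<in>{0..}. Y j t \<omega>) \<in> measurable N ?P" for j
    using Y unfolding prob_space.indep_vars_def2[OF N] by simp
  have G: "G \<in> measurable ?Q (PiM {0..} (\<lambda>_. borel))"
    unfolding G_def
  proof (intro measurable_restrict borel_measurable_vec_lambda)
    fix t :: real and j :: 'j assume "t \<in> {0..}"
    then show "(\<lambda>x. x j t) \<in> borel_measurable ?Q"
      by (intro measurable_compose[where f = "\<lambda>x. x j" and N = ?P and g = "\<lambda>x. x t"]
          measurable_component_singleton) auto
  qed
  have mJ: "?JX \<in> measurable M ?Q" "?JY \<in> measurable N ?Q"
    by (intro measurable_restrict rX) (intro measurable_restrict rY)
  have "distr M ?Q ?JX = PiM UNIV (\<lambda>j. distr M ?P (\<lambda>\<omega>. \<lambda>t\<in>{0..}. X j t \<omega>))"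
    using X rX by (intro prob_space.indep_vars_iff_distr_eq_PiM[OF M, THEN iffD1]) auto
  also have "\<dots> = PiM UNIV (\<lambda>j. distr N ?P (\<lambda>\<omega>. \<lambda>t\<in>{0..}. Y j t \<omega>))"
    unfolding eq ..
  also have "\<dots> = distr N ?Q ?JY"
    using Y rY by (intro prob_space.indep_vars_iff_distr_eq_PiM[OF N, THEN iffD1, symmetric]) auto
  finally have "distr (distr M ?Q ?JX) (PiM {0..} (\<lambda>_. borel)) G = distr (distr N ?Q ?JY) (PiM {0..} (\<lambda>_. borel)) G"
    by simp
  moreover have "G \<circ> ?JX = (\<lambda>\<omega>. \<lambda>t\<in>{0..}. \<chi> j. X j t \<omega>)" "G \<circ> ?JY = (\<lambda>\<omega>. \<lambda>t\<in>{0..}. \<chi> j. Y j t \<omega>)"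
    by (auto simp: G_def fun_eq_iff)
  ultimately show ?thesis
    by (simp add: distr_distr[OF G mJ(1)] distr_distr[OF G mJ(2)])
qed

lemma measurable_stop_path:
  "0 \<le> k \<Longrightarrow> k \<le> K \<Longrightarrow> (\<lambda>x. \<lambda>t\<in>{0..}. x (min t k)) \<in> measurable (PiM {0..K} (\<lambda>_. borel)) (PiM {0..} (\<lambda>_. borel))"
  "0 \<le> k \<Longrightarrow> (\<lambda>x. \<lambda>t\<in>{0..}. x (min t k)) \<in> measurable (PiM {0..} (\<lambda>_. borel)) (PiM {0..} (\<lambda>_. borel))"
  for k K :: real
  by (intro measurable_restrict measurable_component_singleton; auto)+

lemma stopped_brownian_law_unique:
  assumes "standard_brownian_motion M W" "standard_brownian_motion N V" "0 \<le> k"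
  shows "distr M (PiM {0..} (\<lambda>_. borel)) (\<lambda>\<omega>. \<lambda>t\<in>{0..}. W (min t k) \<omega>) =
    distr N (PiM {0..} (\<lambda>_. borel)) (\<lambda>\<omega>. \<lambda>t\<in>{0..}. V (min t k) \<omega>)"
proof -
  interpret M: standard_brownian_motion M W by fact
  interpret N: standard_brownian_motion N V by fact
  let ?P = "PiM {0..} (\<lambda>_. borel) :: (real \<Rightarrow> real) measure"
  let ?R = "\<lambda>x. \<lambda>t\<in>{0..}. x (min t k)"
  have R: "?R \<in> measurable ?P ?P"
    by (rule measurable_stop_path(2)[OF assms(3)])
  have "distr M ?P (\<lambda>\<omega>. \<lambda>t\<in>{0..}. W (min t k) \<omega>) = distr M ?P (?R \<circ> (\<lambda>\<omega>. \<lambda>t\<in>{0..}. W t \<omega>))"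
    using assms(3) by (intro distr_cong) (auto simp: fun_eq_iff)
  also have "\<dots> = distr N ?P (?R \<circ> (\<lambda>\<omega>. \<lambda>t\<in>{0..}. V t \<omega>))"
    using brownian_law_unique[OF assms(1,2)]
    by (simp add: distr_distr[OF R M.measurable_path, symmetric] distr_distr[OF R N.measurable_path, symmetric])
  also have "\<dots> = distr N ?P (\<lambda>\<omega>. \<lambda>t\<in>{0..}. V (min t k) \<omega>)"
    using assms(3) by (intro distr_cong) (auto simp: fun_eq_iff)
  finally show ?thesis .
qed

theorem proposition2:
  fixes \<gamma> :: "'j::{finite,linorder} \<Rightarrow> real \<Rightarrow> real"
    and \<epsilon> :: real
    and M :: "'w measure" and W0 :: "real \<Rightarrow> 'w \<Rightarrow> real"
    and N :: "'v measure" and Wstar :: "real \<Rightarrow> 'v \<Rightarrow> real ^ ('j::{finite,linorder})"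
  assumes "\<And>j r. 0 < r \<Longrightarrow> r < 1 \<Longrightarrow> 0 < \<gamma> j r"
    and "\<And>j. strict_mono_on {0<..<1} (\<gamma> j)"
    and "\<And>j. (\<gamma> j \<longlongrightarrow> 0) (at_right 0)"
    and "\<And>i j. i < j \<Longrightarrow> ((\<lambda>r. \<gamma> j r / \<gamma> i r) \<longlongrightarrow> 0) (at_right 0)"
    and "0 < \<epsilon>" "\<epsilon> < 1"
    and "((\<lambda>r. \<gamma> (Min UNIV) r powr ((2 - \<epsilon>) / (2 + \<epsilon>))
              * sqrt (ln (ln (1 / \<gamma> (Min UNIV) r)))
              * ln (ln (1 / \<gamma> (Max UNIV) r))) \<longlongrightarrow> 0) (at_right 0)"
    and "standard_brownian_motion M W0"
    and "standard_brownian_motion_vec N Wstar"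
  shows "weakly_converges
           M (\<lambda>r \<omega>. cpath_of (\<lambda>t. \<chi> j. \<gamma> j r * W0 (t / (\<gamma> j r)\<^sup>2) \<omega>))
           N (\<lambda>\<omega>. cpath_of (\<lambda>t. Wstar t \<omega>)) (at_right 0)"
proof -
  interpret W: standard_brownian_motion M W0 by fact
  interpret N: standard_brownian_motion_vec N Wstar by fact
  note pos = assms(1) and ratio = assms(4)
  have unit: "\<forall>\<^sub>F r :: real in at_right 0. 0 < r \<and> r < 1"
    using eventually_at_right_real[of 0 "1 :: real"] by simp
  \<comment> \<open>Blocks of length \<open>k + 1\<close> rather than \<open>k\<close> keep the horizon positive also for \<open>k = 0\<close>.\<close>
  define a where "a k r j = (\<Sum>i\<in>{..<j}. (real k + 1) / (\<gamma> i r)\<^sup>2)" for k r j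
  define V where "V k r j t \<omega> = \<gamma> j r * (W0 (a k r j + t / (\<gamma> j r)\<^sup>2) \<omega> - W0 (a k r j) \<omega>)" for k r j t \<omega>
  define Y where "Y k r \<omega> = cpath_of (\<lambda>t. \<chi> j. V k r j (min t (real k)) \<omega>)" for k r \<omega>
  have X_bm: "standard_brownian_motion M (\<lambda>t \<omega>. \<gamma> j r * W0 (t / (\<gamma> j r)\<^sup>2) \<omega>)" if "0 < r" "r < 1" for r j
    using pos[OF that] by (rule W.brownian_scaling)
  have a_nonneg: "0 \<le> a k r j" for k r j
    unfolding a_def by (intro sum_nonneg) auto
  have V_bm: "standard_brownian_motion M (V k r j)" if "0 < r" "r < 1" for k r j
    unfolding V_def using W.brownian_restart[OF a_nonneg pos[OF that]] .
  have a_step: "a k r i + (real k + 1) / (\<gamma> i r)\<^sup>2 \<le> a k r j" if "i < j" for k r i j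
  proof -
    have "a k r i + (real k + 1) / (\<gamma> i r)\<^sup>2 = (\<Sum>l\<in>insert i {..<i}. (real k + 1) / (\<gamma> l r)\<^sup>2)"
      unfolding a_def by simp
    also have "\<dots> \<le> a k r j"
      unfolding a_def using that by (intro sum_mono2) auto
    finally show ?thesis .
  qed
  have V_cont: "continuous_on {0..} (\<lambda>t. \<chi> j. V k r j (min t (real k)) \<omega>)"
    if "0 < r" "r < 1" "\<omega> \<in> space M" for k r \<omega>
    using standard_brownian_motion.continuous_paths[OF V_bm[OF that(1,2)] that(3)]
    by (intro continuous_on_vec_lambda continuous_on_min_time) auto
  have V_meas: "(\<lambda>\<omega>. \<chi> j. V k r j (min t (real k)) \<omega>) \<in> borel_measurable M"
    if "0 < r" "r < 1" "0 \<le> t" for k r t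
    using standard_brownian_motion.measurable_at[OF V_bm[OF that(1,2)]] that(3)
    by (intro borel_measurable_vec_lambda) auto
  have Wstar_cont: "continuous_on {0..} (\<lambda>t. Wstar t \<omega>)" if "\<omega> \<in> space N" for \<omega>
  proof -
    have "continuous_on {0..} (\<lambda>t. \<chi> j. Wstar t \<omega> $ j)"
      using standard_brownian_motion.continuous_paths[OF N.coordinate that]
      by (intro continuous_on_vec_lambda) auto
    then show ?thesis by simp
  qed
  have Wstar_meas: "Wstar t \<in> borel_measurable N" if "0 \<le> t" for t
  proof -
    have "(\<lambda>\<omega>. \<chi> j. Wstar t \<omega> $ j) \<in> borel_measurable N"
      using standard_brownian_motion.measurable_at[OF N.coordinate that]
      by (intro borel_measurable_vec_lambda) auto
    then show ?thesis by simp
  qed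
  let ?Z = "\<lambda>\<omega>. cpath_of (\<lambda>t. Wstar t \<omega>)"
  have stop_Z: "stop (real k) (?Z \<omega>) = cpath_of (\<lambda>t. Wstar (min t (real k)) \<omega>)" if "\<omega> \<in> space N" for k \<omega>
    using Wstar_cont[OF that] by (intro stop_cpath_of) auto
  \<comment> \<open>exact equality of laws, for each \<open>r\<close> and not only in the limit\<close>
  have Y_law: "distr M borel (Y k r) = distr N borel (\<lambda>\<omega>. stop (real k) (?Z \<omega>))" if r: "0 < r" "r < 1" for k r
  proof -
    let ?R = "\<lambda>x. \<lambda>t\<in>{0..}. x (min t (real k)) :: real"
    have "W.indep_vars (\<lambda>_. PiM {0..real k + 1} (\<lambda>_. borel)) (\<lambda>j \<omega>. \<lambda>t\<in>{0..real k + 1}. V k r j t \<omega>) UNIV"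
      unfolding V_def
    proof (rule W.indep_blocks)
      show "a k r i + (real k + 1) / (\<gamma> i r)\<^sup>2 \<le> a k r j \<or> a k r j + (real k + 1) / (\<gamma> j r)\<^sup>2 \<le> a k r i"
        if "i \<noteq> j" for i j
        using that a_step[of i j] a_step[of j i] by (cases i j rule: linorder_cases) auto
    qed (use a_nonneg pos r in auto)
    then have "W.indep_vars (\<lambda>_. PiM {0..} (\<lambda>_. borel)) (\<lambda>j \<omega>. ?R (\<lambda>t\<in>{0..real k + 1}. V k r j t \<omega>)) UNIV"
      by (rule W.indep_vars_compose2) (rule measurable_stop_path; simp)
    moreover have "?R (\<lambda>t\<in>{0..real k + 1}. V k r j t \<omega>) = (\<lambda>t\<in>{0..}. V k r j (min t (real k)) \<omega>)" for j \<omega>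
      by (auto simp: fun_eq_iff)
    ultimately have iV: "W.indep_vars (\<lambda>_. PiM {0..} (\<lambda>_. borel)) (\<lambda>j \<omega>. \<lambda>t\<in>{0..}. V k r j (min t (real k)) \<omega>) UNIV"
      by simp
    have "N.indep_vars (\<lambda>_. PiM {0..} (\<lambda>_. borel)) (\<lambda>j \<omega>. ?R (\<lambda>t\<in>{0..}. Wstar t \<omega> $ j)) UNIV"
      using N.independent_coordinates by (rule N.indep_vars_compose2) (rule measurable_stop_path; simp)
    moreover have "?R (\<lambda>t\<in>{0..}. Wstar t \<omega> $ j) = (\<lambda>t\<in>{0..}. Wstar (min t (real k)) \<omega> $ j)" for j \<omega>
      by (auto simp: fun_eq_iff)
    ultimately have iW: "N.indep_vars (\<lambda>_. PiM {0..} (\<lambda>_. borel)) (\<lambda>j \<omega>. \<lambda>t\<in>{0..}. Wstar (min t (real k)) \<omega> $ j) UNIV"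
      by simp
    have "distr M (PiM {0..} (\<lambda>_. borel)) (\<lambda>\<omega>. \<lambda>t\<in>{0..}. \<chi> j. V k r j (min t (real k)) \<omega>) =
        distr N (PiM {0..} (\<lambda>_. borel)) (\<lambda>\<omega>. \<lambda>t\<in>{0..}. \<chi> j. Wstar (min t (real k)) \<omega> $ j)"
      using stopped_brownian_law_unique[OF V_bm[OF r] N.coordinate]
      by (intro distr_vec_path_eqI W.prob_space_axioms N.prob_space_axioms iV iW) simp
    then have "distr M borel (Y k r) = distr N borel (\<lambda>\<omega>. cpath_of (\<lambda>t. Wstar (min t (real k)) \<omega>))"
      unfolding Y_def using r V_cont V_meas Wstar_cont Wstar_meas
      by (intro distr_cpath_of_eqI) (auto intro!: continuous_on_min_time simp del: continuous_on_vec_lambda)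
    also have "\<dots> = distr N borel (\<lambda>\<omega>. stop (real k) (?Z \<omega>))"
      by (intro distr_cong refl) (simp add: stop_Z)
    finally show ?thesis .
  qed
  show ?thesis
  proof (rule weakly_converges_approx[where Y = Y])
    show "prob_space M" "prob_space N" by unfold_locales
    show "?Z \<in> borel_measurable N"
      using Wstar_meas Wstar_cont by (rule measurable_cpath_of)
    show "(\<lambda>\<omega>. stop (real k) (?Z \<omega>)) \<in> borel_measurable N" for k
    proof -
      have "(\<lambda>\<omega>. cpath_of (\<lambda>t. Wstar (min t (real k)) \<omega>)) \<in> borel_measurable N"
        using Wstar_meas Wstar_cont by (intro measurable_cpath_of continuous_on_min_time) auto
      then show ?thesis by (simp add: stop_Z cong: measurable_cong)
    qed
    show "\<forall>\<^sub>F r in at_right 0. (\<lambda>\<omega>. cpath_of (\<lambda>t. \<chi> j. \<gamma> j r * W0 (t / (\<gamma> j r)\<^sup>2) \<omega>)) \<in> borel_measurable M"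
      using unit
    proof eventually_elim
      case (elim r)
      then show ?case
        using standard_brownian_motion.measurable_at[OF X_bm] standard_brownian_motion.continuous_paths[OF X_bm]
        by (intro measurable_cpath_of borel_measurable_vec_lambda continuous_on_vec_lambda) auto
    qed
    show "\<forall>\<^sub>F r in at_right 0. Y k r \<in> borel_measurable M \<and>
        distr M borel (Y k r) = distr N borel (\<lambda>\<omega>. stop (real k) (?Z \<omega>))" for k
      using unit
    proof eventually_elim
      case (elim r)
      then show ?case
        using V_meas V_cont Y_law by (auto simp: Y_def[abs_def] intro!: measurable_cpath_of)
    qed
    fix k :: nat and d e :: real assume "0 < d" "0 < e"
    let ?J = "real CARD('j)"
    have J: "?J > 0" by simp
    obtain h E where h: "0 < h" and E: "E \<in> sets (PiM {0..} (\<lambda>_. borel))"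
      and pE: "W.prob ((\<lambda>\<omega>. \<lambda>t\<in>{0..}. W0 t \<omega>) -` E \<inter> space M) < e / ?J"
      and shift: "\<And>x t s. continuous_on {0..} x \<Longrightarrow> (\<lambda>t\<in>{0..}. x t) \<notin> E \<Longrightarrow> t \<in> {0..real k + 1} \<Longrightarrow> s \<in> {0..h} \<Longrightarrow>
        \<bar>x t - (x (s + t) - x s)\<bar> \<le> d / ?J"
      using W.small_shift_oscillation[of "real k + 1" "d / ?J" "e / ?J"] \<open>0 < d\<close> \<open>0 < e\<close> J
      by (metis add_nonneg_pos divide_pos_pos of_nat_0_le_iff zero_less_one)
    \<comment> \<open>the start of block \<open>j\<close>, measured on the time scale of coordinate \<open>j\<close>\<close>
    have "((\<lambda>r. a k r j * (\<gamma> j r)\<^sup>2) \<longlongrightarrow> 0) (at_right 0)" for j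
    proof -
      have "((\<lambda>r. \<Sum>i<j. (real k + 1) * (\<gamma> j r / \<gamma> i r)\<^sup>2) \<longlongrightarrow> (\<Sum>i<j. (real k + 1) * 0\<^sup>2)) (at_right 0)"
        by (intro tendsto_intros ratio) auto
      moreover have "(\<Sum>i<j. (real k + 1) * (\<gamma> j r / \<gamma> i r)\<^sup>2) = a k r j * (\<gamma> j r)\<^sup>2" for r
        unfolding a_def sum_distrib_right by (simp add: power_divide)
      ultimately show ?thesis by simp
    qed
    then have "\<forall>\<^sub>F r in at_right 0. \<forall>j. a k r j * (\<gamma> j r)\<^sup>2 < h"
      by (intro eventually_all_finite order_tendstoD(2)[OF _ h])
    then show "\<forall>\<^sub>F r in at_right 0. \<exists>A\<in>sets M. measure M A < e \<and> (\<forall>\<omega>\<in>space M - A. \<forall>t\<in>{0..real k}.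
        dist (cpath_apply (cpath_of (\<lambda>t. \<chi> j. \<gamma> j r * W0 (t / (\<gamma> j r)\<^sup>2) \<omega>)) t) (cpath_apply (Y k r \<omega>) t) \<le> d)"
      using unit
    proof eventually_elim
      case (elim r)
      then have r: "0 < r" "r < 1" by auto
      let ?X = "\<lambda>j t \<omega>. \<gamma> j r * W0 (t / (\<gamma> j r)\<^sup>2) \<omega>"
      let ?A = "\<lambda>j. (\<lambda>\<omega>. \<lambda>t\<in>{0..}. ?X j t \<omega>) -` E \<inter> space M"
      have X_path: "(\<lambda>\<omega>. \<lambda>t\<in>{0..}. ?X j t \<omega>) \<in> measurable M (PiM {0..} (\<lambda>_. borel))" for j
        using standard_brownian_motion.measurable_path[OF X_bm[OF r]] .
      have A_sets: "?A j \<in> sets M" for j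
        using measurable_sets[OF X_path E] .
      have "W.prob (?A j) = W.prob ((\<lambda>\<omega>. \<lambda>t\<in>{0..}. W0 t \<omega>) -` E \<inter> space M)" for j
        using brownian_law_unique[OF X_bm[OF r] W.standard_brownian_motion_axioms]
          measure_distr[OF X_path E] measure_distr[OF W.measurable_path E] by metis
      then have pA: "W.prob (?A j) < e / ?J" for j using pE by simp
      have "W.prob (\<Union>j. ?A j) \<le> (\<Sum>j\<in>UNIV. W.prob (?A j))"
        using A_sets by (intro W.finite_measure_subadditive_finite) auto
      also have "\<dots> < (\<Sum>j\<in>(UNIV :: 'j set). e / ?J)"
        using pA by (intro sum_strict_mono) auto
      also have "\<dots> = e" using J by simp
      finally have "W.prob (\<Union>j. ?A j) < e" .
      moreover have "dist (cpath_apply (cpath_of (\<lambda>t. \<chi> j. ?X j t \<omega>)) t) (cpath_apply (Y k r \<omega>) t) \<le> d"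
        if \<omega>: "\<omega> \<in> space M" "\<omega> \<notin> (\<Union>j. ?A j)" and t: "t \<in> {0..real k}" for \<omega> t
      proof -
        have X_cont: "continuous_on {0..} (\<lambda>t. ?X j t \<omega>)" for j
          using standard_brownian_motion.continuous_paths[OF X_bm[OF r] \<omega>(1)] .
        have "\<bar>?X j t \<omega> - V k r j t \<omega>\<bar> \<le> d / ?J" for j
        proof -
          let ?s = "a k r j * (\<gamma> j r)\<^sup>2"
          have g: "\<gamma> j r > 0" using pos r by auto
          have "\<bar>?X j t \<omega> - (?X j (?s + t) \<omega> - ?X j ?s \<omega>)\<bar> \<le> d / ?J"
            using \<omega> t elim(1) a_nonneg[of k r j] by (intro shift[OF X_cont]) (auto simp: less_imp_le)
          moreover have "?X j (?s + t) \<omega> - ?X j ?s \<omega> = V k r j t \<omega>"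
            unfolding V_def using g by (simp add: add_divide_distrib algebra_simps)
          ultimately show ?thesis by simp
        qed
        then have "(\<Sum>j\<in>UNIV. \<bar>((\<chi> j. ?X j t \<omega>) - (\<chi> j. V k r j t \<omega>)) $ j\<bar>) \<le> (\<Sum>j\<in>(UNIV :: 'j set). d / ?J)"
          by (intro sum_mono) simp
        also have "\<dots> = d" using J by simp
        finally have "dist (\<chi> j. ?X j t \<omega>) (\<chi> j. V k r j t \<omega>) \<le> d"
          using norm_le_l1_cart[of "(\<chi> j. ?X j t \<omega>) - (\<chi> j. V k r j t \<omega>)"] unfolding dist_norm by linarith
        moreover have "cpath_apply (cpath_of (\<lambda>t. \<chi> j. ?X j t \<omega>)) t = (\<chi> j. ?X j t \<omega>)"
          using X_cont t by (intro cpath_apply_cpath_of continuous_on_vec_lambda) auto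
        moreover have "cpath_apply (Y k r \<omega>) t = (\<chi> j. V k r j t \<omega>)"
          unfolding Y_def using cpath_apply_cpath_of[OF V_cont[OF r \<omega>(1)], of t k] t by (simp add: min_absorb1)
        ultimately show ?thesis by simp
      qed
      moreover have "(\<Union>j. ?A j) \<in> sets M"
        using A_sets by (intro sets.finite_UN) auto
      ultimately show ?case
        by (intro bexI[of _ "\<Union>j. ?A j"] conjI ballI) blast+
    qed
  qed
qed

end
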